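(* Let $\mathbf{k}$ be a commutative ring and let $\mathfrak{g}$ be a $\mathbf{k}$-module (viewed as an $\mathbb{S}$-module concentrated in degree zero). Twisted Lie algebra structures on $\Sigma\mathfrak{g}[t]$ over $\mathbf{k}[t]$ are canonically equivalent to (right) pre-Lie structures $\circ:\mathfrak{g}\otimes\mathfrak{g}\to\mathfrak{g}$ on $\mathfrak{g}$. The equivalence is given by $$\{x,y\}=(x\circ y)\,t-t\,(y\circ x),\qquad \forall x,y\in\mathfrak{g}.$$ Moreover, such twisted Lie algebras $\Sigma\mathfrak{g}[t]$ are in fact the associated Lie algebras of twisted pre-Lie algebras.
   Context: An $\mathbb{S}$-module is an $\mathbb{N}$-graded $\mathbf{k}$-module $M=\bigoplus_{m\ge0}M_m$ with an action of the symmetric group $S_m$ on $M_m$ by $\mathbf{k}$-module automorphisms; morphisms are graded and equivariant. The tensor product is $M\otimes_{\mathbb{S}}N=\bigoplus_p\bigoplus_{m+n=p}\operatorname{Ind}_{S_m\times S_n}^{S_p}M_m\otimes N_n$. Block permutations: for $i_1,\dots,i_n\ge0$ with sum $r$ and $\sigma\in S_n$, $\sigma^{i_1,\dots,i_n}\in S_r$ is the permutation which moves the $j$-th of the consecutive blocks of sizes $i_1,\dots,i_n$ to the $\sigma(j)$-th place, preserving the order inside each block (after permuting, the successive blocks have sizes $i_{\sigma^{-1}(1)},\dots,i_{\sigma^{-1}(n)}$). The degree of a homogeneous element $x$ is $|x|$; identities are for homogeneous elements. A twisted Lie algebra is an $\mathbb{S}$-module $\mathfrak{h}$ with a morphism of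 $\mathbb{S}$-modules $\mathfrak{h}\otimes_{\mathbb{S}}\mathfrak{h}\to\mathfrak{h}$ (equivalently, a graded bilinear operation $\{\,,\}$ that is $S_m\times S_n\subseteq S_{m+n}$-equivariant on $\mathfrak{h}_m\otimes\mathfrak{h}_n\to\mathfrak{h}_{m+n}$) satisfying $\{x,y\}=-(12)^{|y|,|x|}\{y,x\}$ and $\{x,\{y,z\}\}+(123)^{|y|,|z|,|x|}\{y,\{z,x\}\}+(132)^{|z|,|x|,|y|}\{z,\{x,y\}\}=0$. A twisted pre-Lie algebra is an $\mathbb{S}$-module $\mathfrak{h}$ with an $\mathbb{S}$-module morphism $\circ:\mathfrak{h}\otimes_{\mathbb{S}}\mathfrak{h}\to\mathfrak{h}$ satisfying $(x\circ y)\circ z-x\circ(y\circ z)=(23)^{|x|,|z|,|y|}\bigl((x\circ z)\circ y-x\circ(z\circ y)\bigr)$; its associated twisted Lie algebra has bracket $\{x,y\}=x\circ y-(12)^{|y|,|x|}(y\circ x)$. An ordinary (right) pre-Lie structure on a $\mathbf{k}$-module is a bilinear operation with $x\circ(y\circ z)-(x\circ y)\circ z=x\circ(z\circ y)-(x\circ z)\circ y$. $\Sigma\mathfrak{g}$ is the $\mathbb{S}$-module with $(\Sigma\mathfrak{g})_1=\mathfrak{g}$ and $(\Sigma\mathfrak{g})_m=0$ for $m\ne1$; elements of $\mathfrak{g}$ are also regarded as elements of $\Sigma\mathfrak{g}$. $\mathbf{k}[t]$ is the $\mathbb{S}$-module with $|t|=1$ and trivial $S_m$-action on $t^m$ (a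 twisted commutative algebra). $\Sigma\mathfrak{g}[t]:=\Sigma\mathfrak{g}\otimes_{\mathbb{S}}\mathbf{k}[t]\cong\mathbf{k}[t]\otimes\Sigma\mathfrak{g}\otimes\mathbf{k}[t]$: in degree $m$ it is $\bigoplus_{a+b=m-1}t^a\,\mathfrak{g}\,t^b$, and $S_m$ acts by permuting positions, i.e. $\sigma$ sends $t^axt^b$ to the element with $x$ in position $\sigma(a+1)$ and $t$ in all other positions. A twisted Lie algebra structure on $\Sigma\mathfrak{g}[t]$ over $\mathbf{k}[t]$ is a twisted Lie bracket which is $\mathbf{k}[t]$-linear, i.e. $\{tf,g\}=t\{f,g\}$ for all $f,g$. *)

theory Defs
  imports "HOL-Algebra.Module" "HOL-Algebra.Group_Action" "HOL-Algebra.Sym_Groups"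
begin

text \<open>
  A graded module is a family of modules \<open>M m\<close> over one ring. All identities are stated on homogeneous
  elements, the degrees being explicit arguments. As for \<^const>\<open>BijGroup\<close>, operations are
  extensional functions on the carriers, so that two operations are equal iff they agree on the
  carriers. Permuted products are compared along \<open>M (n + m) = M (m + n)\<close>.
\<close>

definition bilinear_op ::
  "('a, 'r) ring_scheme \<Rightarrow> ('a, 'b, 'x) module_scheme \<Rightarrow> ('a, 'c, 'y) module_scheme
    \<Rightarrow> ('a, 'd, 'z) module_scheme \<Rightarrow> ('b \<Rightarrow> 'c \<Rightarrow> 'd) \<Rightarrow> bool"
  where "bilinear_op R A B C f \<longleftrightarrow>
    f \<in> carrier A \<rightarrow>\<^sub>E carrier B \<rightarrow>\<^sub>E carrier C \<and>
    (\<forall>x\<in>carrier A. \<forall>x'\<in>carrier A. \<forall>y\<in>carrier B. f (x \<oplus>\<^bsub>A\<^esub> x') y = f x y \<oplus>\<^bsub>C\<^esub> f x' y) \<and>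
    (\<forall>x\<in>carrier A. \<forall>y\<in>carrier B. \<forall>y'\<in>carrier B. f x (y \<oplus>\<^bsub>B\<^esub> y') = f x y \<oplus>\<^bsub>C\<^esub> f x y') \<and>
    (\<forall>a\<in>carrier R. \<forall>x\<in>carrier A. \<forall>y\<in>carrier B. f (a \<odot>\<^bsub>A\<^esub> x) y = a \<odot>\<^bsub>C\<^esub> f x y) \<and>
    (\<forall>a\<in>carrier R. \<forall>x\<in>carrier A. \<forall>y\<in>carrier B. f x (a \<odot>\<^bsub>B\<^esub> y) = a \<odot>\<^bsub>C\<^esub> f x y)"


subsection \<open>Block permutations\<close>

text \<open>
  A position \<open>k\<close> in the \<open>j\<close>-th of the consecutive blocks of sizes \<open>is\<close> keeps its offset in the block,
  and the block is shifted to start after all blocks \<open>l\<close> with \<open>\<sigma> l < \<sigma> j\<close>. Blocks and positions are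
  numbered from 1.
\<close>

definition block_perm :: "(nat \<Rightarrow> nat) \<Rightarrow> nat list \<Rightarrow> nat \<Rightarrow> nat"
  where "block_perm \<sigma> is k =
    (if k \<in> {1..sum_list is}
     then let j = (LEAST j. k \<le> sum_list (take j is))
          in (k - sum_list (take (j - 1) is)) + (\<Sum>l | l \<in> {1..length is} \<and> \<sigma> l < \<sigma> j. is ! (l - 1))
     else k)"

text \<open>The image of \<open>(\<sigma>, \<tau>)\<close> under the inclusion of \<open>S\<^sub>m \<times> S\<^sub>n\<close> into \<open>S\<^bsub>m+n\<^esub>\<close>.\<close>

definition juxtapose :: "nat \<Rightarrow> (nat \<Rightarrow> nat) \<Rightarrow> (nat \<Rightarrow> nat) \<Rightarrow> nat \<Rightarrow> nat"
  where "juxtapose m \<sigma> \<tau> k = (if k \<le> m then \<sigma> k else m + \<tau> (k - m))"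


subsection \<open>Twisted algebras\<close>

locale S_module =
  fixes R :: "('a, 'r) ring_scheme"
    and M :: "nat \<Rightarrow> ('a, 'b) module"
    and act :: "nat \<Rightarrow> (nat \<Rightarrow> nat) \<Rightarrow> 'b \<Rightarrow> 'b"
  assumes cring: "cring R"
    and module: "module R (M m)"
    and action: "group_action (sym_group m) (carrier (M m)) (act m)"
    and act_add: "\<lbrakk>\<sigma> \<in> carrier (sym_group m); x \<in> carrier (M m); y \<in> carrier (M m)\<rbrakk>
      \<Longrightarrow> act m \<sigma> (x \<oplus>\<^bsub>M m\<^esub> y) = act m \<sigma> x \<oplus>\<^bsub>M m\<^esub> act m \<sigma> y"
    and act_smult: "\<lbrakk>\<sigma> \<in> carrier (sym_group m); a \<in> carrier R; x \<in> carrier (M m)\<rbrakk>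
      \<Longrightarrow> act m \<sigma> (a \<odot>\<^bsub>M m\<^esub> x) = a \<odot>\<^bsub>M m\<^esub> act m \<sigma> x"

text \<open>
  A morphism from the induced tensor square of an \<open>S\<close>-module to itself, given as the corresponding
  family of equivariant bilinear maps \<open>M m \<times> M n \<rightarrow> M (m + n)\<close>.
\<close>

locale S_module_op = S_module +
  fixes opn :: "nat \<Rightarrow> nat \<Rightarrow> 'b \<Rightarrow> 'b \<Rightarrow> 'b"
  assumes bilinear: "bilinear_op R (M m) (M n) (M (m + n)) (opn m n)"
    and equivariant: "\<lbrakk>\<sigma> \<in> carrier (sym_group m); \<tau> \<in> carrier (sym_group n);
        x \<in> carrier (M m); y \<in> carrier (M n)\<rbrakk>
      \<Longrightarrow> opn m n (act m \<sigma> x) (act n \<tau> y) = act (m + n) (juxtapose m \<sigma> \<tau>) (opn m n x y)"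

locale twisted_lie_algebra = S_module_op R M act br for R M act br +
  assumes antisym: "\<lbrakk>x \<in> carrier (M m); y \<in> carrier (M n)\<rbrakk>
      \<Longrightarrow> br m n x y =
        \<ominus>\<^bsub>M (m + n)\<^esub> act (m + n) (block_perm (cycle_of_list [1, 2]) [n, m]) (br n m y x)"
    and jacobi: "\<lbrakk>x \<in> carrier (M m); y \<in> carrier (M n); z \<in> carrier (M l)\<rbrakk>
      \<Longrightarrow> br m (n + l) x (br n l y z)
          \<oplus>\<^bsub>M (m + n + l)\<^esub>
          act (m + n + l) (block_perm (cycle_of_list [1, 2, 3]) [n, l, m])
            (br n (l + m) y (br l m z x))
          \<oplus>\<^bsub>M (m + n + l)\<^esub>
          act (m + n + l) (block_perm (cycle_of_list [1, 3, 2]) [l, m, n])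
            (br l (m + n) z (br m n x y))
        = \<zero>\<^bsub>M (m + n + l)\<^esub>"

locale twisted_pre_lie_algebra = S_module_op R M act pl for R M act pl +
  assumes twisted_pre_lie: "\<lbrakk>x \<in> carrier (M m); y \<in> carrier (M n); z \<in> carrier (M l)\<rbrakk>
      \<Longrightarrow> pl (m + n) l (pl m n x y) z \<ominus>\<^bsub>M (m + n + l)\<^esub> pl m (n + l) x (pl n l y z)
        = act (m + n + l) (block_perm (cycle_of_list [2, 3]) [m, l, n])
            (pl (m + l) n (pl m l x z) y \<ominus>\<^bsub>M (m + n + l)\<^esub> pl m (l + n) x (pl l n z y))"

definition associated_bracket ::
  "(nat \<Rightarrow> ('a, 'b) module) \<Rightarrow> (nat \<Rightarrow> (nat \<Rightarrow> nat) \<Rightarrow> 'b \<Rightarrow> 'b)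
    \<Rightarrow> (nat \<Rightarrow> nat \<Rightarrow> 'b \<Rightarrow> 'b \<Rightarrow> 'b) \<Rightarrow> nat \<Rightarrow> nat \<Rightarrow> 'b \<Rightarrow> 'b \<Rightarrow> 'b"
  where "associated_bracket M act pl m n =
    (\<lambda>x\<in>carrier (M m). \<lambda>y\<in>carrier (M n).
      pl m n x y \<ominus>\<^bsub>M (m + n)\<^esub>
        act (m + n) (block_perm (cycle_of_list [1, 2]) [n, m]) (pl n m y x))"

locale pre_lie_algebra = module R G for R (structure) and G (structure) +
  fixes pl :: "'c \<Rightarrow> 'c \<Rightarrow> 'c"
  assumes bilinear: "bilinear_op R G G G pl"
    and pre_lie: "\<lbrakk>x \<in> carrier G; y \<in> carrier G; z \<in> carrier G\<rbrakk>
      \<Longrightarrow> pl x (pl y z) \<ominus>\<^bsub>G\<^esub> pl (pl x y) z = pl x (pl z y) \<ominus>\<^bsub>G\<^esub> pl (pl x z) y"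


subsection \<open>The \<open>S\<close>-module \<open>\<Sigma>\<gg>[t]\<close>\<close>

text \<open>
  The degree \<open>m\<close> part, the direct sum of the \<open>t\<^sup>a \<gg> t\<^sup>b\<close> with \<open>a + b = m - 1\<close>, is modelled by the
  functions from the positions \<open>{1..m}\<close> to \<open>\<gg>\<close>: the value at \<open>i\<close> is the component with \<open>a = i - 1\<close>. The
  fields \<^const>\<open>mult\<close> and \<^const>\<open>one\<close> of the record play no role in a module.
\<close>

definition Sigma_t :: "('a, 'b, 'x) module_scheme \<Rightarrow> nat \<Rightarrow> ('a, nat \<Rightarrow> 'b) module"
  where "Sigma_t G m =
    \<lparr>carrier = {1..m} \<rightarrow>\<^sub>E carrier G,
     monoid.mult = undefined,
     one = undefined,
     zero = (\<lambda>i\<in>{1..m}. \<zero>\<^bsub>G\<^esub>),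
     add = (\<lambda>f g. \<lambda>i\<in>{1..m}. f i \<oplus>\<^bsub>G\<^esub> g i),
     smult = (\<lambda>c f. \<lambda>i\<in>{1..m}. c \<odot>\<^bsub>G\<^esub> f i)\<rparr>"

text \<open>Moving the entry in position \<open>i\<close> to position \<open>\<sigma> i\<close>.\<close>

definition Sigma_t_act ::
  "('a, 'b, 'x) module_scheme \<Rightarrow> nat \<Rightarrow> (nat \<Rightarrow> nat) \<Rightarrow> (nat \<Rightarrow> 'b) \<Rightarrow> nat \<Rightarrow> 'b"
  where "Sigma_t_act G m \<sigma> = (\<lambda>f\<in>carrier (Sigma_t G m). \<lambda>i\<in>{1..m}. f (inv' \<sigma> i))"

text \<open>The element \<open>t\<^sup>a x t\<^sup>b\<close>; an element \<open>x\<close> of \<open>\<gg>\<close> is regarded as \<open>t\<^sup>0 x t\<^sup>0\<close>.\<close>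

definition t_elem :: "('a, 'b, 'x) module_scheme \<Rightarrow> nat \<Rightarrow> 'b \<Rightarrow> nat \<Rightarrow> nat \<Rightarrow> 'b"
  where "t_elem G a x b = (\<lambda>i\<in>{1..a + 1 + b}. if i = a + 1 then x else \<zero>\<^bsub>G\<^esub>)"

text \<open>Left multiplication by \<open>t\<close> on the degree \<open>m\<close> part, \<open>t \<cdot> t\<^sup>a x t\<^sup>b = t\<^bsup>a+1\<^esup> x t\<^sup>b\<close>.\<close>

definition t_mult :: "('a, 'b, 'x) module_scheme \<Rightarrow> nat \<Rightarrow> (nat \<Rightarrow> 'b) \<Rightarrow> nat \<Rightarrow> 'b"
  where "t_mult G m f = (\<lambda>i\<in>{1..Suc m}. if i = 1 then \<zero>\<^bsub>G\<^esub> else f (i - 1))"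

locale twisted_lie_over_kt =
  twisted_lie_algebra R "Sigma_t G" "Sigma_t_act G" br
  for R :: "('a, 'r) ring_scheme" and G :: "('a, 'b, 'x) module_scheme" and br +
  assumes t_linear: "\<lbrakk>f \<in> carrier (Sigma_t G m); g \<in> carrier (Sigma_t G n)\<rbrakk>
      \<Longrightarrow> br (Suc m) n (t_mult G m f) g = t_mult G (m + n) (br m n f g)"

end

theory Submission
  imports Defs
begin

text \<open>
  Write \<open>S f\<close> for the image of \<open>f\<close> under \<open>t \<mapsto> 1\<close>, the sum of its entries. A bilinear product \<open>\<circ>\<close> on \<open>\<gg>\<close>
  extends to \<open>\<Sigma>\<gg>[t]\<close> by letting every entry of \<open>f\<close> in \<open>f \<circ> g\<close> be multiplied by \<open>S g\<close>, followed by
  zeros in the positions of \<open>g\<close>. The bracket associated with this product has the entries \<open>x \<circ> S g\<close>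
  in the positions of \<open>f\<close> and \<open>- (y \<circ> S f)\<close> in those of \<open>g\<close>, and at each position its Jacobi sum is
  an instance of the pre-Lie identity. Conversely, antisymmetry shows that a bracket on \<open>\<Sigma>\<gg>[t]\<close> has the
  shape \<open>(x \<circ> y) t - t (y \<circ> x)\<close> on \<open>\<gg>\<close>, and there it determines the bracket: linearity over \<open>k[t]\<close>
  and antisymmetry give \<open>{t\<^sup>a x, t\<^sup>b y}\<close>, and since \<open>S\<^sub>m\<close> permutes the positions transitively,
  equivariance gives all other positions.
\<close>

section \<open>The \<open>S\<close>-module \<open>\<Sigma>\<gg>[t]\<close>\<close>

text \<open>The numeral 1 is kept, because it is the left end of every range of positions and the
  degree of the elements of \<gg>.\<close>

declare One_nat_def [simp del]

lemma carrier_Sigma_t: "carrier (Sigma_t G m) = {1..m} \<rightarrow>\<^sub>E carrier G"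
  by (simp add: Sigma_t_def)

lemma add_Sigma_t: "i \<in> {1..m} \<Longrightarrow> (f \<oplus>\<^bsub>Sigma_t G m\<^esub> g) i = f i \<oplus>\<^bsub>G\<^esub> g i"
  by (simp add: Sigma_t_def)

lemma smult_Sigma_t: "i \<in> {1..m} \<Longrightarrow> (a \<odot>\<^bsub>Sigma_t G m\<^esub> f) i = a \<odot>\<^bsub>G\<^esub> f i"
  by (simp add: Sigma_t_def)

lemma zero_Sigma_t: "i \<in> {1..m} \<Longrightarrow> \<zero>\<^bsub>Sigma_t G m\<^esub> i = \<zero>\<^bsub>G\<^esub>"
  by (simp add: Sigma_t_def)

lemma Sigma_t_apply: "f \<in> carrier (Sigma_t G m) \<Longrightarrow> i \<in> {1..m} \<Longrightarrow> f i \<in> carrier G"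
  by (auto simp: carrier_Sigma_t)

lemma Sigma_t_eqI:
  assumes "f \<in> carrier (Sigma_t G m)" "g \<in> carrier (Sigma_t G m)" "\<And>i. i \<in> {1..m} \<Longrightarrow> f i = g i"
  shows "f = g"
  using assms by (metis PiE_ext carrier_Sigma_t)

lemma (in module) module_Sigma_t: "module R (Sigma_t M m)"
proof (intro moduleI abelian_groupI)
  fix f assume f: "f \<in> carrier (Sigma_t M m)"
  have "(\<lambda>i\<in>{1..m}. \<ominus>\<^bsub>M\<^esub> f i) \<oplus>\<^bsub>Sigma_t M m\<^esub> f = \<zero>\<^bsub>Sigma_t M m\<^esub>"
  proof -
    have "\<ominus>\<^bsub>M\<^esub> f i \<oplus>\<^bsub>M\<^esub> f i = \<zero>\<^bsub>M\<^esub>" if "i \<in> {1..m}" for i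
      using Sigma_t_apply[OF f that] by (rule M.l_neg)
    then show ?thesis
      by (auto simp: Sigma_t_def intro!: restrict_ext)
  qed
  moreover have "(\<lambda>i\<in>{1..m}. \<ominus>\<^bsub>M\<^esub> f i) \<in> carrier (Sigma_t M m)"
    using f by (auto simp: Sigma_t_def)
  ultimately show "\<exists>g\<in>carrier (Sigma_t M m). g \<oplus>\<^bsub>Sigma_t M m\<^esub> f = \<zero>\<^bsub>Sigma_t M m\<^esub>" ..
  show "\<zero>\<^bsub>Sigma_t M m\<^esub> \<oplus>\<^bsub>Sigma_t M m\<^esub> f = f"
    using f by (auto simp: Sigma_t_def PiE_iff intro!: extensionalityI[of _ "{1..m}"])
  show "\<one> \<odot>\<^bsub>Sigma_t M m\<^esub> f = f"
    using f by (auto simp: Sigma_t_def PiE_iff intro!: extensionalityI[of _ "{1..m}"])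
qed (auto simp: Sigma_t_def R.cring_axioms M.a_ac smult_l_distr smult_r_distr smult_assoc1 PiE_iff
    intro!: restrict_ext)

text \<open>Negation is not a field of the record but the inverse for its addition, so its entries
  follow from uniqueness of inverses in \<open>M\<close>.\<close>

lemma (in module) a_inv_Sigma_t:
  assumes "f \<in> carrier (Sigma_t M m)" "i \<in> {1..m}"
  shows "(\<ominus>\<^bsub>Sigma_t M m\<^esub> f) i = \<ominus>\<^bsub>M\<^esub> f i"
proof -
  interpret S: module R "Sigma_t M m" by (rule module_Sigma_t)
  have "(\<ominus>\<^bsub>Sigma_t M m\<^esub> f) i \<oplus>\<^bsub>M\<^esub> f i = (\<ominus>\<^bsub>Sigma_t M m\<^esub> f \<oplus>\<^bsub>Sigma_t M m\<^esub> f) i"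
    using assms by (simp add: add_Sigma_t)
  also have "\<dots> = \<zero>\<^bsub>M\<^esub>"
    using assms by (simp add: S.l_neg zero_Sigma_t)
  finally show ?thesis
    using assms by (metis M.minus_equality S.a_inv_closed Sigma_t_apply)
qed

lemma (in module) minus_Sigma_t:
  assumes "f \<in> carrier (Sigma_t M m)" "g \<in> carrier (Sigma_t M m)" "i \<in> {1..m}"
  shows "(f \<ominus>\<^bsub>Sigma_t M m\<^esub> g) i = f i \<ominus>\<^bsub>M\<^esub> g i"
  using assms by (simp add: a_minus_def add_Sigma_t a_inv_Sigma_t)

section \<open>The action of the symmetric groups by permuting positions\<close>

lemma Sigma_t_act_apply:
  "f \<in> carrier (Sigma_t G m) \<Longrightarrow> i \<in> {1..m} \<Longrightarrow> Sigma_t_act G m \<sigma> f i = f (inv' \<sigma> i)"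
  by (simp add: Sigma_t_act_def)

lemma Sigma_t_act_closed:
  assumes "\<sigma> permutes {1..m}" "f \<in> carrier (Sigma_t G m)"
  shows "Sigma_t_act G m \<sigma> f \<in> carrier (Sigma_t G m)"
  using assms permutes_in_image[OF permutes_inv[OF assms(1)]]
  by (auto simp: Sigma_t_act_def carrier_Sigma_t)

text \<open>Reading the entry at \<open>inv' \<sigma> i\<close> gives a left action: inversion and
  precomposition both reverse the order.\<close>

lemma Sigma_t_act_comp:
  assumes "\<sigma> permutes {1..m}" "\<tau> permutes {1..m}" "f \<in> carrier (Sigma_t G m)"
  shows "Sigma_t_act G m (\<sigma> \<circ> \<tau>) f = Sigma_t_act G m \<sigma> (Sigma_t_act G m \<tau> f)"
proof (rule Sigma_t_eqI[of _ G m])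
  fix i assume i: "i \<in> {1..m}"
  have "inv' (\<sigma> \<circ> \<tau>) = inv' \<tau> \<circ> inv' \<sigma>"
    using assms by (meson o_inv_distrib permutes_bij)
  moreover have "inv' \<sigma> i \<in> {1..m}"
    using permutes_in_image[OF permutes_inv[OF assms(1)]] i by blast
  ultimately show "Sigma_t_act G m (\<sigma> \<circ> \<tau>) f i = Sigma_t_act G m \<sigma> (Sigma_t_act G m \<tau> f) i"
    using assms i by (simp add: Sigma_t_act_apply Sigma_t_act_closed)
qed (use assms in \<open>simp_all add: Sigma_t_act_closed permutes_compose\<close>)

lemma Sigma_t_act_inv:
  assumes "\<sigma> permutes {1..m}" "f \<in> carrier (Sigma_t G m)"
  shows "Sigma_t_act G m \<sigma> (Sigma_t_act G m (inv' \<sigma>) f) = f"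
proof (rule Sigma_t_eqI[of _ G m])
  fix i assume i: "i \<in> {1..m}"
  have "inv' \<sigma> i \<in> {1..m}"
    using permutes_in_image[OF permutes_inv[OF assms(1)]] i by blast
  then show "Sigma_t_act G m \<sigma> (Sigma_t_act G m (inv' \<sigma>) f) i = f i"
    using assms i
    by (simp add: Sigma_t_act_apply Sigma_t_act_closed permutes_inv permutes_inv_inv permutes_inverses)
qed (use assms in \<open>simp_all add: Sigma_t_act_closed permutes_inv\<close>)

text \<open>\<open>Bij\<close> contains only extensional bijections; the outer restriction in
  \<open>Sigma_t_act\<close> is what puts the action there.\<close>

lemma Sigma_t_act_Bij:
  assumes "\<sigma> permutes {1..m}"
  shows "Sigma_t_act G m \<sigma> \<in> Bij (carrier (Sigma_t G m))"
proof -
  have "bij_betw (Sigma_t_act G m \<sigma>) (carrier (Sigma_t G m)) (carrier (Sigma_t G m))"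
    using assms Sigma_t_act_inv[OF assms] Sigma_t_act_inv[OF permutes_inv[OF assms]]
    by (intro bij_betw_byWitness[where f' = "Sigma_t_act G m (inv' \<sigma>)"])
      (auto simp: Sigma_t_act_closed permutes_inv permutes_inv_inv)
  then show ?thesis
    by (simp add: Bij_def Sigma_t_act_def)
qed

lemma Sigma_t_group_action:
  "group_action (sym_group m) (carrier (Sigma_t G m)) (Sigma_t_act G m)"
proof (intro group_action.intro group_hom.intro group_hom_axioms.intro homI)
  fix \<sigma> \<tau> assume "\<sigma> \<in> carrier (sym_group m)" "\<tau> \<in> carrier (sym_group m)"
  then have st: "\<sigma> permutes {1..m}" "\<tau> permutes {1..m}"
    by (simp_all add: sym_group_carrier)
  have "Sigma_t_act G m (\<sigma> \<circ> \<tau>)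
      = compose (carrier (Sigma_t G m)) (Sigma_t_act G m \<sigma>) (Sigma_t_act G m \<tau>)"
    by (rule extensionalityI[of _ "carrier (Sigma_t G m)"])
      (simp_all add: compose_eq Sigma_t_act_comp st, simp add: Sigma_t_act_def)
  then show "Sigma_t_act G m (\<sigma> \<otimes>\<^bsub>sym_group m\<^esub> \<tau>)
    = Sigma_t_act G m \<sigma> \<otimes>\<^bsub>BijGroup (carrier (Sigma_t G m))\<^esub> Sigma_t_act G m \<tau>"
    by (simp add: BijGroup_def sym_group_mult Sigma_t_act_Bij st)
qed (simp_all add: sym_group_is_group group_BijGroup sym_group_carrier Sigma_t_act_Bij,
    simp add: BijGroup_def sym_group_carrier Sigma_t_act_Bij)

lemma (in module) S_module_Sigma_t: "S_module R (Sigma_t M) (Sigma_t_act M)"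
proof (intro S_module.intro)
  fix \<sigma> m f g assume "\<sigma> \<in> carrier (sym_group m)" and f: "f \<in> carrier (Sigma_t M m)"
  then have \<sigma>: "\<sigma> permutes {1..m}"
    by (simp add: sym_group_carrier)
  interpret S: module R "Sigma_t M m" by (rule module_Sigma_t)
  have i: "inv' \<sigma> i \<in> {1..m}" if "i \<in> {1..m}" for i
    using permutes_in_image[OF permutes_inv[OF \<sigma>]] that by blast
  show "Sigma_t_act M m \<sigma> (f \<oplus>\<^bsub>Sigma_t M m\<^esub> g)
      = Sigma_t_act M m \<sigma> f \<oplus>\<^bsub>Sigma_t M m\<^esub> Sigma_t_act M m \<sigma> g"
    if "g \<in> carrier (Sigma_t M m)"
    using \<sigma> f that i
    by (intro Sigma_t_eqI[of _ M m]) (simp_all add: Sigma_t_act_closed Sigma_t_act_apply add_Sigma_t)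
  show "Sigma_t_act M m \<sigma> (a \<odot>\<^bsub>Sigma_t M m\<^esub> f) = a \<odot>\<^bsub>Sigma_t M m\<^esub> Sigma_t_act M m \<sigma> f"
    if "a \<in> carrier R" for a
    using \<sigma> f that i
    by (intro Sigma_t_eqI[of _ M m]) (simp_all add: Sigma_t_act_closed Sigma_t_act_apply smult_Sigma_t)
qed (simp_all add: R.cring_axioms module_Sigma_t Sigma_t_group_action)

section \<open>Block permutations\<close>

text \<open>Both cyclic permutations of three blocks exchange one block with the other two.\<close>

definition block_swap :: "nat \<Rightarrow> nat \<Rightarrow> nat \<Rightarrow> nat"
  where "block_swap a b k =
    (if 1 \<le> k \<and> k \<le> a then k + b else if a < k \<and> k \<le> a + b then k - a else k)"

lemma block_swap_swap: "block_swap b a (block_swap a b k) = k"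
  by (auto simp: block_swap_def)

lemma inv_block_swap: "inv' (block_swap a b) = block_swap b a"
  by (rule inv_equality) (rule block_swap_swap)+

lemma block_swap_permutes: "block_swap a b permutes {1..a + b}"
proof (rule bij_imp_permutes)
  show "bij_betw (block_swap a b) {1..a + b} {1..a + b}"
    by (rule bij_betw_byWitness[where f' = "block_swap b a"])
      (auto simp: block_swap_swap, auto simp: block_swap_def)
qed (auto simp: block_swap_def)

lemma sum_list_take_mono: "i \<le> j \<Longrightarrow> sum_list (take i xs) \<le> sum_list (take j xs)"
  for xs :: "nat list"
  using take_add[of i "j - i" xs] by simp

text \<open>The partial sums of the sizes locate the block of \<open>k\<close>, which evaluates the
  \<open>LEAST\<close>. The shift becomes a conditional sum over \<open>l < length is\<close>, which
  simplification expands term by term for an explicit list.\<close>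

lemma block_perm_eq:
  assumes j: "j \<in> {1..length is}" and k: "sum_list (take (j - 1) is) < k" "k \<le> sum_list (take j is)"
  shows "block_perm \<sigma> is k = k - sum_list (take (j - 1) is)
    + (\<Sum>l<length is. if \<sigma> (Suc l) < \<sigma> j then is ! l else 0)"
proof -
  have "(LEAST j. k \<le> sum_list (take j is)) = j"
  proof (rule Least_equality)
    fix y assume "k \<le> sum_list (take y is)"
    then show "j \<le> y"
      using k(1) sum_list_take_mono[of y "j - 1" "is"] by linarith
  qed (rule k(2))
  moreover have "k \<in> {1..sum_list is}"
    using k j sum_list_take_mono[of j "length is" "is"] by auto
  moreover have "(\<Sum>l | l \<in> {1..length is} \<and> \<sigma> l < \<sigma> j. is ! (l - 1))
      = (\<Sum>l<length is. if \<sigma> (Suc l) < \<sigma> j then is ! l else 0)"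
    by (simp add: sum.If_cases)
      (rule sum.reindex_bij_witness[of _ Suc "\<lambda>l. l - 1"], auto)
  ultimately show ?thesis
    by (simp add: block_perm_def)
qed

lemma block_perm_outside: "k \<notin> {1..sum_list is} \<Longrightarrow> block_perm \<sigma> is k = k"
  by (auto simp: block_perm_def)

lemmas block_perm_eval = block_swap_def transpose_def numeral_eq_Suc One_nat_def

lemma block_perm_12: "block_perm (cycle_of_list [1, 2]) [a, b] = block_swap a b"
proof
  fix k
  consider "k \<notin> {1..a + b}" | "1 \<le> k" "k \<le> a" | "a < k" "k \<le> a + b" by fastforce
  then show "block_perm (cycle_of_list [1, 2]) [a, b] k = block_swap a b k"
  proof cases
    case 1
    then show ?thesis by (auto simp: block_perm_outside block_swap_def)
  next
    case 2
    then show ?thesis by (subst block_perm_eq[of 1]) (auto simp: block_perm_eval)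
  next
    case 3
    then show ?thesis by (subst block_perm_eq[of 2]) (auto simp: block_perm_eval)
  qed
qed

text \<open>The cycle sends block 1 to place 2, block 2 to place 3 and block 3 to place 1, so the
  first two blocks pass the third together.\<close>

lemma block_perm_123: "block_perm (cycle_of_list [1, 2, 3]) [a, b, c] = block_swap (a + b) c"
proof
  fix k
  consider "k \<notin> {1..a + b + c}" | "1 \<le> k" "k \<le> a" | "a < k" "k \<le> a + b"
    | "a + b < k" "k \<le> a + b + c" by fastforce
  then show "block_perm (cycle_of_list [1, 2, 3]) [a, b, c] k = block_swap (a + b) c k"
  proof cases
    case 1
    then show ?thesis by (auto simp: block_perm_outside block_swap_def)
  next
    case 2
    then show ?thesis by (subst block_perm_eq[of 1]) (auto simp: block_perm_eval)
  next
    case 3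
    then show ?thesis by (subst block_perm_eq[of 2]) (auto simp: block_perm_eval)
  next
    case 4
    then show ?thesis by (subst block_perm_eq[of 3]) (auto simp: block_perm_eval)
  qed
qed

text \<open>Here block 1 goes to place 3 while blocks 2 and 3 go to places 1 and 2, so the last two
  blocks move together.\<close>

lemma block_perm_132: "block_perm (cycle_of_list [1, 3, 2]) [a, b, c] = block_swap a (b + c)"
proof
  fix k
  consider "k \<notin> {1..a + b + c}" | "1 \<le> k" "k \<le> a" | "a < k" "k \<le> a + b"
    | "a + b < k" "k \<le> a + b + c" by fastforce
  then show "block_perm (cycle_of_list [1, 3, 2]) [a, b, c] k = block_swap a (b + c) k"
  proof cases
    case 1
    then show ?thesis by (auto simp: block_perm_outside block_swap_def)
  next
    case 2
    then show ?thesis by (subst block_perm_eq[of 1]) (auto simp: block_perm_eval)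
  next
    case 3
    then show ?thesis by (subst block_perm_eq[of 2]) (auto simp: block_perm_eval)
  next
    case 4
    then show ?thesis by (subst block_perm_eq[of 3]) (auto simp: block_perm_eval)
  qed
qed

text \<open>Written as a juxtaposition, this permutation gets its inverse and its range from the
  general lemmas on \<open>juxtapose\<close>.\<close>

lemma block_perm_23:
  "block_perm (cycle_of_list [2, 3]) [a, b, c] = juxtapose a id (block_swap b c)"
proof
  fix k
  consider "k \<notin> {1..a + b + c}" | "1 \<le> k" "k \<le> a" | "a < k" "k \<le> a + b"
    | "a + b < k" "k \<le> a + b + c" by fastforce
  then show "block_perm (cycle_of_list [2, 3]) [a, b, c] k = juxtapose a id (block_swap b c) k"
  proof cases
    case 1
    then show ?thesis by (auto simp: block_perm_outside juxtapose_def block_swap_def)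
  next
    case 2
    then show ?thesis by (subst block_perm_eq[of 1]) (auto simp: block_perm_eval juxtapose_def)
  next
    case 3
    then show ?thesis by (subst block_perm_eq[of 2]) (auto simp: block_perm_eval juxtapose_def)
  next
    case 4
    then show ?thesis by (subst block_perm_eq[of 3]) (auto simp: block_perm_eval juxtapose_def)
  qed
qed

section \<open>Products on \<open>\<Sigma>\<gg>[t]\<close> from bilinear products on \<open>\<gg>\<close>\<close>

text \<open>Turns the pre-Lie identity, an equation between two differences, into the vanishing of
  one sum, grouped as in the Jacobi computation.\<close>

lemma (in abelian_group) minus_eq_minus_iff:
  assumes "a \<in> carrier G" "b \<in> carrier G" "c \<in> carrier G" "d \<in> carrier G"
  shows "a \<ominus> b = c \<ominus> d \<longleftrightarrow> a \<ominus> c \<oplus> (d \<ominus> b) = \<zero>"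
proof -
  have "a \<ominus> b = c \<ominus> d \<longleftrightarrow> (a \<ominus> b) \<ominus> (c \<ominus> d) = \<zero>"
    using assms by (metis a_minus_def minus_closed r_neg add.inv_solve_right' l_zero)
  also have "(a \<ominus> b) \<ominus> (c \<ominus> d) = a \<ominus> c \<oplus> (d \<ominus> b)"
    using assms by (simp add: a_minus_def minus_add a_ac)
  finally show ?thesis .
qed

text \<open>The substitution \<open>t \<mapsto> 1\<close>.\<close>

definition aug :: "('a, 'b, 'x) module_scheme \<Rightarrow> nat \<Rightarrow> (nat \<Rightarrow> 'b) \<Rightarrow> 'b"
  where "aug G m f = (\<Oplus>\<^bsub>G\<^esub>i\<in>{1..m}. f i)"

context module
begin

lemma aug_closed [simp]: "f \<in> carrier (Sigma_t M m) \<Longrightarrow> aug M m f \<in> carrier M"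
  unfolding aug_def by (intro M.finsum_closed) (auto simp: carrier_Sigma_t)

lemma aug_cong:
  "(\<And>i. i \<in> {1..m} \<Longrightarrow> f i = g i) \<Longrightarrow> (\<And>i. i \<in> {1..m} \<Longrightarrow> g i \<in> carrier M)
    \<Longrightarrow> aug M m f = aug M m g"
  unfolding aug_def by (rule M.finsum_cong') auto

lemma aug_add:
  assumes "f \<in> carrier (Sigma_t M m)" "g \<in> carrier (Sigma_t M m)"
  shows "aug M m (f \<oplus>\<^bsub>Sigma_t M m\<^esub> g) = aug M m f \<oplus>\<^bsub>M\<^esub> aug M m g"
proof -
  have "aug M m (f \<oplus>\<^bsub>Sigma_t M m\<^esub> g) = aug M m (\<lambda>i. f i \<oplus>\<^bsub>M\<^esub> g i)"
    using assms by (intro aug_cong) (auto simp: add_Sigma_t Sigma_t_apply)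
  also have "\<dots> = aug M m f \<oplus>\<^bsub>M\<^esub> aug M m g"
    unfolding aug_def using assms by (intro M.finsum_addf) (auto simp: carrier_Sigma_t)
  finally show ?thesis .
qed

lemma aug_smult:
  assumes "a \<in> carrier R" "f \<in> carrier (Sigma_t M m)"
  shows "aug M m (a \<odot>\<^bsub>Sigma_t M m\<^esub> f) = a \<odot>\<^bsub>M\<^esub> aug M m f"
proof -
  have "aug M m (a \<odot>\<^bsub>Sigma_t M m\<^esub> f) = aug M m (\<lambda>i. a \<odot>\<^bsub>M\<^esub> f i)"
    using assms by (intro aug_cong) (auto simp: smult_Sigma_t Sigma_t_apply)
  also have "\<dots> = a \<odot>\<^bsub>M\<^esub> aug M m f"
    unfolding aug_def using assms by (subst finsum_smult_ldistr) (auto simp: carrier_Sigma_t)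
  finally show ?thesis .
qed

text \<open>A sum over all positions is unchanged by reindexing, so permuting one factor does not
  affect the entries in the positions of the other.\<close>

lemma aug_act:
  assumes "\<sigma> permutes {1..m}" "f \<in> carrier (Sigma_t M m)"
  shows "aug M m (Sigma_t_act M m \<sigma> f) = aug M m f"
proof -
  have \<sigma>: "inv' \<sigma> ` {1..m} = {1..m}"
    by (rule permutes_image[OF permutes_inv[OF assms(1)]])
  have "aug M m (Sigma_t_act M m \<sigma> f) = aug M m (\<lambda>i. f (inv' \<sigma> i))"
    using assms(2) \<sigma> by (intro aug_cong) (auto simp: Sigma_t_act_apply carrier_Sigma_t)
  also have "\<dots> = (\<Oplus>\<^bsub>M\<^esub>i\<in>inv' \<sigma> ` {1..m}. f i)"
    unfolding aug_def using assms(2) \<sigma>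
    by (intro M.finsum_reindex[symmetric] permutes_inj_on[OF permutes_inv[OF assms(1)]])
      (auto simp: carrier_Sigma_t)
  finally show ?thesis
    by (simp add: \<sigma> aug_def)
qed

lemma aug_split:
  assumes "f \<in> carrier (Sigma_t M (m + n))"
  shows "aug M (m + n) f = aug M m f \<oplus>\<^bsub>M\<^esub> aug M n (\<lambda>i. f (m + i))"
proof -
  have [simp]: "f i \<in> carrier M" if "i \<in> {1..m + n}" for i
    using assms that by (auto simp: carrier_Sigma_t)
  have *: "{1..m + n} = {1..m} \<union> (+) m ` {1..n}"
    by (auto simp: image_iff intro: bexI[of _ "_ - m"])
  have "aug M (m + n) f = aug M m f \<oplus>\<^bsub>M\<^esub> (\<Oplus>\<^bsub>M\<^esub>i\<in>(+) m ` {1..n}. f i)"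
    unfolding aug_def * by (intro M.finsum_Un_disjoint) auto
  also have "(\<Oplus>\<^bsub>M\<^esub>i\<in>(+) m ` {1..n}. f i) = aug M n (\<lambda>i. f (m + i))"
    unfolding aug_def by (intro M.finsum_reindex) auto
  finally show ?thesis .
qed

lemma t_mult_closed: "f \<in> carrier (Sigma_t M m) \<Longrightarrow> t_mult M m f \<in> carrier (Sigma_t M (Suc m))"
  by (force simp: carrier_Sigma_t t_mult_def)

text \<open>Position 1 contributes zero and the shifted tail is \<open>f\<close> again:
  multiplication by t is invisible under t \<mapsto> 1.\<close>

lemma aug_t_mult:
  assumes "f \<in> carrier (Sigma_t M m)"
  shows "aug M (Suc m) (t_mult M m f) = aug M m f"
proof -
  have [simp]: "f i \<in> carrier M" if "i \<in> {1..m}" for i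
    using assms that by (auto simp: carrier_Sigma_t)
  have "aug M (1 + m) (t_mult M m f)
      = aug M 1 (t_mult M m f) \<oplus>\<^bsub>M\<^esub> aug M m (\<lambda>i. t_mult M m f (1 + i))"
    using t_mult_closed[OF assms] by (intro aug_split) (simp only: plus_1_eq_Suc)
  also have "aug M 1 (t_mult M m f) = \<zero>\<^bsub>M\<^esub>"
    by (simp add: aug_def t_mult_def)
  also have "aug M m (\<lambda>i. t_mult M m f (1 + i)) = aug M m f"
    by (intro aug_cong) (auto simp: t_mult_def)
  finally show ?thesis
    using assms by (simp only: plus_1_eq_Suc M.l_zero aug_closed)
qed

end

section \<open>Inverses and ranges of juxtaposed permutations\<close>

lemma juxtapose_inverse:
  assumes "\<sigma> permutes {1..m}" "\<tau> permutes {1..n}"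
  shows "juxtapose m (inv' \<sigma>) (inv' \<tau>) (juxtapose m \<sigma> \<tau> k) = k"
proof -
  have "\<sigma> k \<le> m \<longleftrightarrow> k \<le> m"
    using permutes_in_image[OF assms(1), of k] permutes_not_in[OF assms(1), of k] by auto
  \<comment> \<open>Positions count from 1, so \<open>\<tau>\<close> never produces the offset 0,
    and a position of the second block stays beyond \<open>m\<close>.\<close>
  moreover have "0 < \<tau> j" if "0 < j" for j
    using permutes_in_image[OF assms(2), of j] permutes_not_in[OF assms(2), of j] that by fastforce
  from this[of "k - m"] have "m < k \<Longrightarrow> \<not> m + \<tau> (k - m) \<le> m"
    by simp
  ultimately show ?thesis
    using permutes_inverses[OF assms(1)] permutes_inverses[OF assms(2)]
    by (auto simp: juxtapose_def)
qed

lemma juxtapose_inverse':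
  assumes "\<sigma> permutes {1..m}" "\<tau> permutes {1..n}"
  shows "juxtapose m \<sigma> \<tau> (juxtapose m (inv' \<sigma>) (inv' \<tau>) k) = k"
  using juxtapose_inverse[OF permutes_inv[OF assms(1)] permutes_inv[OF assms(2)]] assms
  by (simp add: permutes_inv_inv)

lemma inv_juxtapose:
  "\<sigma> permutes {1..m} \<Longrightarrow> \<tau> permutes {1..n} \<Longrightarrow>
    inv' (juxtapose m \<sigma> \<tau>) = juxtapose m (inv' \<sigma>) (inv' \<tau>)"
  by (intro inv_equality juxtapose_inverse juxtapose_inverse')

lemma juxtapose_permutes:
  assumes "\<sigma> permutes {1..m}" "\<tau> permutes {1..n}"
  shows "juxtapose m \<sigma> \<tau> permutes {1..m + n}"
proof (rule bij_imp_permutes)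
  have im: "juxtapose m \<rho> \<pi> k \<in> {1..m + n}"
    if "\<rho> permutes {1..m}" "\<pi> permutes {1..n}" "k \<in> {1..m + n}" for \<rho> \<pi> k
    using permutes_in_image[OF that(1), of k] permutes_in_image[OF that(2), of "k - m"] that(3)
    by (fastforce simp: juxtapose_def)
  show "bij_betw (juxtapose m \<sigma> \<tau>) {1..m + n} {1..m + n}"
    using im[OF assms] im[OF permutes_inv[OF assms(1)] permutes_inv[OF assms(2)]]
    by (intro bij_betw_byWitness[where f' = "juxtapose m (inv' \<sigma>) (inv' \<tau>)"])
      (simp_all add: juxtapose_inverse[OF assms] juxtapose_inverse'[OF assms] image_subset_iff)
  show "juxtapose m \<sigma> \<tau> k = k" if "k \<notin> {1..m + n}" for k
  proof -
    have "k - m \<notin> {1..n}"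
      using that by auto
    then show ?thesis
      using permutes_not_in[OF assms(1), of k] permutes_not_in[OF assms(2), of "k - m"] that
      by (auto simp: juxtapose_def)
  qed
qed

text \<open>A product for which the pre-Lie identity is still open: the one read off from a bracket
  is first known to be bilinear only, and the identity is then matched with Jacobi.\<close>

locale bilinear_product = module R G for R (structure) and G (structure) +
  fixes pl :: "'c \<Rightarrow> 'c \<Rightarrow> 'c"
  assumes bilinear_pl: "bilinear_op R G G G pl"
begin

lemma pl_closed [simp]: "x \<in> carrier G \<Longrightarrow> y \<in> carrier G \<Longrightarrow> pl x y \<in> carrier G"
  using bilinear_pl by (auto simp: bilinear_op_def)

lemma
  assumes "x \<in> carrier G" "y \<in> carrier G"
  shows pl_add_left: "x' \<in> carrier G \<Longrightarrow> pl (x \<oplus>\<^bsub>G\<^esub> x') y = pl x y \<oplus>\<^bsub>G\<^esub> pl x' y"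
    and pl_add_right: "y' \<in> carrier G \<Longrightarrow> pl x (y \<oplus>\<^bsub>G\<^esub> y') = pl x y \<oplus>\<^bsub>G\<^esub> pl x y'"
    and pl_smult_left: "a \<in> carrier R \<Longrightarrow> pl (a \<odot>\<^bsub>G\<^esub> x) y = a \<odot>\<^bsub>G\<^esub> pl x y"
    and pl_smult_right: "a \<in> carrier R \<Longrightarrow> pl x (a \<odot>\<^bsub>G\<^esub> y) = a \<odot>\<^bsub>G\<^esub> pl x y"
  using bilinear_pl assms by (auto simp: bilinear_op_def)

lemma pl_zero_left [simp]: "y \<in> carrier G \<Longrightarrow> pl \<zero>\<^bsub>G\<^esub> y = \<zero>\<^bsub>G\<^esub>"
  using pl_smult_left[of "\<zero>\<^bsub>G\<^esub>" y "\<zero>\<^bsub>R\<^esub>"] by simp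

lemma pl_zero_right [simp]: "x \<in> carrier G \<Longrightarrow> pl x \<zero>\<^bsub>G\<^esub> = \<zero>\<^bsub>G\<^esub>"
  using pl_smult_right[of x "\<zero>\<^bsub>G\<^esub>" "\<zero>\<^bsub>R\<^esub>"] by simp

lemma pl_a_inv_left:
  assumes "x \<in> carrier G" "y \<in> carrier G"
  shows "pl (\<ominus>\<^bsub>G\<^esub> x) y = \<ominus>\<^bsub>G\<^esub> pl x y"
proof -
  have "pl (\<ominus>\<^bsub>G\<^esub> x) y \<oplus>\<^bsub>G\<^esub> pl x y = \<zero>\<^bsub>G\<^esub>"
    using assms by (simp add: pl_add_left[symmetric] M.l_neg)
  then show ?thesis
    using assms by (intro M.minus_equality[symmetric]) simp_all
qed

lemma pl_a_inv_right:
  assumes "x \<in> carrier G" "y \<in> carrier G"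
  shows "pl x (\<ominus>\<^bsub>G\<^esub> y) = \<ominus>\<^bsub>G\<^esub> pl x y"
proof -
  have "pl x (\<ominus>\<^bsub>G\<^esub> y) \<oplus>\<^bsub>G\<^esub> pl x y = \<zero>\<^bsub>G\<^esub>"
    using assms by (simp add: pl_add_right[symmetric] M.l_neg)
  then show ?thesis
    using assms by (intro M.minus_equality[symmetric]) simp_all
qed

lemmas pl_simps = pl_add_left pl_add_right pl_smult_left pl_smult_right pl_a_inv_left pl_a_inv_right

lemma pl_finsum_left:
  assumes "finite A" "y \<in> carrier G" "f \<in> A \<rightarrow> carrier G"
  shows "pl (\<Oplus>\<^bsub>G\<^esub>i\<in>A. f i) y = (\<Oplus>\<^bsub>G\<^esub>i\<in>A. pl (f i) y)"
  using assms by (induction A) (simp_all add: pl_add_left Pi_iff)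

lemma pl_aug:
  "f \<in> carrier (Sigma_t G m) \<Longrightarrow> y \<in> carrier G \<Longrightarrow> aug G m (\<lambda>i. pl (f i) y) = pl (aug G m f) y"
  unfolding aug_def by (rule pl_finsum_left[symmetric]) (auto simp: carrier_Sigma_t)

end

text \<open>
  The choice \<open>h = 0\<close> is the twisted pre-Lie product and \<open>h = - id\<close> is its associated bracket.
\<close>

definition sigma_op :: "('a, 'b, 'x) module_scheme \<Rightarrow> ('b \<Rightarrow> 'b) \<Rightarrow> ('b \<Rightarrow> 'b \<Rightarrow> 'b)
    \<Rightarrow> nat \<Rightarrow> nat \<Rightarrow> (nat \<Rightarrow> 'b) \<Rightarrow> (nat \<Rightarrow> 'b) \<Rightarrow> nat \<Rightarrow> 'b"
  where "sigma_op G h pl m n =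
    (\<lambda>f\<in>carrier (Sigma_t G m). \<lambda>g\<in>carrier (Sigma_t G n). \<lambda>i\<in>{1..m + n}.
      if i \<le> m then pl (f i) (aug G n g) else h (pl (g (i - m)) (aug G m f)))"

lemma sigma_op_left:
  assumes "f \<in> carrier (Sigma_t G m)" "g \<in> carrier (Sigma_t G n)" "i \<in> {1..m}"
  shows "sigma_op G h pl m n f g i = pl (f i) (aug G n g)"
  using assms by (simp add: sigma_op_def)

lemma sigma_op_right:
  assumes "f \<in> carrier (Sigma_t G m)" "g \<in> carrier (Sigma_t G n)" "i \<in> {1..n}"
  shows "sigma_op G h pl m n f g (m + i) = h (pl (g i) (aug G m f))"
  using assms by (simp add: sigma_op_def)

text \<open>Unfolded repeatedly, this splits \<open>{1..m + n + l}\<close> into three blocks, one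
  for each factor of a triple product.\<close>

lemma ball_blocks: "(\<forall>k\<in>{1..m + n}. P k) \<longleftrightarrow> (\<forall>i\<in>{1..m}. P i) \<and> (\<forall>i\<in>{1..n}. P (m + i))"
  for m n :: nat
proof -
  have "P k" if "\<forall>i\<in>{1..m}. P i" "\<forall>i\<in>{1..n}. P (m + i)" "k \<in> {1..m + n}" for k
    using that(1) bspec[OF that(2), of "k - m"] that(3) by (cases "k \<le> m") (auto simp: One_nat_def Suc_le_eq)
  then show ?thesis
    by auto
qed

lemma Sigma_t_blocks_eqI:
  assumes "f \<in> carrier (Sigma_t G (m + n))" "g \<in> carrier (Sigma_t G (m + n))"
    and "\<And>i. i \<in> {1..m} \<Longrightarrow> f i = g i" "\<And>i. i \<in> {1..n} \<Longrightarrow> f (m + i) = g (m + i)"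
  shows "f = g"
  using assms ball_blocks[of m n "\<lambda>i. f i = g i"] by (intro Sigma_t_eqI[OF assms(1,2)]) simp

text \<open>Both \<open>0\<close> and \<open>- id\<close> are linear, so one set of proofs of
  closure, bilinearity and equivariance serves the twisted pre-Lie product and its bracket.\<close>

locale sigma_product = bilinear_product +
  fixes h :: "'c \<Rightarrow> 'c"
  assumes h_closed: "x \<in> carrier G \<Longrightarrow> h x \<in> carrier G"
    and h_add: "x \<in> carrier G \<Longrightarrow> y \<in> carrier G \<Longrightarrow> h (x \<oplus>\<^bsub>G\<^esub> y) = h x \<oplus>\<^bsub>G\<^esub> h y"
    and h_smult: "a \<in> carrier R \<Longrightarrow> x \<in> carrier G \<Longrightarrow> h (a \<odot>\<^bsub>G\<^esub> x) = a \<odot>\<^bsub>G\<^esub> h x"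
begin

lemma h_zero: "h \<zero>\<^bsub>G\<^esub> = \<zero>\<^bsub>G\<^esub>"
  using h_smult[of "\<zero>\<^bsub>R\<^esub>" "\<zero>\<^bsub>G\<^esub>"] by (simp add: h_closed)

lemma h_finsum:
  assumes "finite A" "f \<in> A \<rightarrow> carrier G"
  shows "h (\<Oplus>\<^bsub>G\<^esub>i\<in>A. f i) = (\<Oplus>\<^bsub>G\<^esub>i\<in>A. h (f i))"
  using assms by (induction A) (simp_all add: h_zero h_closed h_add Pi_iff)

lemma sigma_op_closed:
  assumes f: "f \<in> carrier (Sigma_t G m)" and g: "g \<in> carrier (Sigma_t G n)"
  shows "sigma_op G h pl m n f g \<in> carrier (Sigma_t G (m + n))"
proof -
  have "\<forall>i\<in>{1..m + n}. sigma_op G h pl m n f g i \<in> carrier G"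
    unfolding ball_blocks using assms by (simp add: sigma_op_left sigma_op_right Sigma_t_apply h_closed)
  then show ?thesis
    using assms by (auto simp: carrier_Sigma_t[of _ "m + n"] PiE_iff) (simp add: sigma_op_def)
qed

text \<open>Under t \<mapsto> 1 the product becomes \<open>pl\<close> for \<open>h = 0\<close> and
  the commutator of \<open>pl\<close> for \<open>h = - id\<close>. This evaluates an inner product
  standing as the second factor.\<close>

lemma aug_sigma_op:
  assumes f: "f \<in> carrier (Sigma_t G m)" and g: "g \<in> carrier (Sigma_t G n)"
  shows "aug G (m + n) (sigma_op G h pl m n f g)
    = pl (aug G m f) (aug G n g) \<oplus>\<^bsub>G\<^esub> h (pl (aug G n g) (aug G m f))"
proof -
  have "aug G (m + n) (sigma_op G h pl m n f g)
    = aug G m (\<lambda>i. pl (f i) (aug G n g)) \<oplus>\<^bsub>G\<^esub> aug G n (\<lambda>i. h (pl (g i) (aug G m f)))"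
    using assms
    by (subst aug_split[OF sigma_op_closed[OF assms]], intro arg_cong2[of _ _ _ _ "add G"] aug_cong)
      (auto simp: sigma_op_left sigma_op_right Sigma_t_apply h_closed)
  also have "aug G n (\<lambda>i. h (pl (g i) (aug G m f))) = h (aug G n (\<lambda>i. pl (g i) (aug G m f)))"
    unfolding aug_def[of G n] using assms by (intro h_finsum[symmetric]) (auto simp: Sigma_t_apply)
  finally show ?thesis
    using assms by (simp add: pl_aug)
qed

lemma bilinear_sigma_op:
  "bilinear_op R (Sigma_t G m) (Sigma_t G n) (Sigma_t G (m + n)) (sigma_op G h pl m n)"
proof -
  interpret S: module R "Sigma_t G k" for k by (rule module_Sigma_t)
  show ?thesis
    unfolding bilinear_op_def
  proof (intro conjI ballI)
    show "sigma_op G h pl m n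
        \<in> carrier (Sigma_t G m) \<rightarrow>\<^sub>E carrier (Sigma_t G n) \<rightarrow>\<^sub>E carrier (Sigma_t G (m + n))"
      by (rule PiE_I, rule PiE_I) (auto simp: sigma_op_closed, auto simp: sigma_op_def)
  qed (rule Sigma_t_blocks_eqI[of _ G m n], simp_all
      add: sigma_op_left sigma_op_right sigma_op_closed Sigma_t_apply add_Sigma_t smult_Sigma_t
        aug_add aug_smult pl_simps h_closed h_add h_smult)+
qed

text \<open>Entries move only within their own block, and the sum of the other factor does not
  change.\<close>

lemma sigma_op_equivariant:
  assumes st: "\<sigma> permutes {1..m}" "\<tau> permutes {1..n}"
    and fg: "f \<in> carrier (Sigma_t G m)" "g \<in> carrier (Sigma_t G n)"
  shows "sigma_op G h pl m n (Sigma_t_act G m \<sigma> f) (Sigma_t_act G n \<tau> g)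
    = Sigma_t_act G (m + n) (juxtapose m \<sigma> \<tau>) (sigma_op G h pl m n f g)"
proof (rule Sigma_t_blocks_eqI[of _ G m n])
  have s: "inv' \<sigma> i \<in> {1..m}" if "i \<in> {1..m}" for i
    using permutes_in_image[OF permutes_inv[OF st(1)], of i] that by blast
  have t: "inv' \<tau> i \<in> {1..n}" if "i \<in> {1..n}" for i
    using permutes_in_image[OF permutes_inv[OF st(2)], of i] that by blast
  note simps = sigma_op_left sigma_op_right Sigma_t_act_apply Sigma_t_act_closed aug_act
    sigma_op_closed inv_juxtapose juxtapose_def
  show "sigma_op G h pl m n (Sigma_t_act G m \<sigma> f) (Sigma_t_act G n \<tau> g) i
      = Sigma_t_act G (m + n) (juxtapose m \<sigma> \<tau>) (sigma_op G h pl m n f g) i" if "i \<in> {1..m}" for i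
    using st fg that s[OF that] by (simp add: simps)
  show "sigma_op G h pl m n (Sigma_t_act G m \<sigma> f) (Sigma_t_act G n \<tau> g) (m + i)
      = Sigma_t_act G (m + n) (juxtapose m \<sigma> \<tau>) (sigma_op G h pl m n f g) (m + i)"
    if "i \<in> {1..n}" for i
    using st fg that t[OF that] by (simp add: simps)
qed (use st fg in \<open>simp_all add: Sigma_t_act_closed sigma_op_closed juxtapose_permutes\<close>)

lemma S_module_op_sigma_op: "S_module_op R (Sigma_t G) (Sigma_t_act G) (sigma_op G h pl)"
  by (intro S_module_op.intro S_module_Sigma_t S_module_op_axioms.intro bilinear_sigma_op)
    (simp add: sigma_op_equivariant sym_group_carrier)

end

context bilinear_product
begin

lemma sigma_product_zero: "sigma_product R G pl (\<lambda>_. \<zero>\<^bsub>G\<^esub>)"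
  by unfold_locales simp_all

lemma sigma_product_a_inv: "sigma_product R G pl (a_inv G)"
  by unfold_locales (simp_all add: M.minus_add smult_r_minus)

end

text \<open>After exchanging blocks of sizes \<open>a\<close> and \<open>b\<close>, the one of size
  \<open>b\<close> comes first. The degree is a separate \<open>c\<close>, since a swapped product
  arises in degree \<open>n + m\<close> but is compared in degree \<open>m + n\<close>.\<close>

lemma
  assumes "f \<in> carrier (Sigma_t G c)" "c = a + b"
  shows act_block_swap_left: "i \<in> {1..b} \<Longrightarrow> Sigma_t_act G c (block_swap a b) f i = f (a + i)"
    and act_block_swap_right: "i \<in> {1..a} \<Longrightarrow> Sigma_t_act G c (block_swap a b) f (b + i) = f i"
  using assms by (simp_all add: Sigma_t_act_apply inv_block_swap block_swap_def add.commute)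

lemma act_block_swap_closed:
  "f \<in> carrier (Sigma_t G c) \<Longrightarrow> c = a + b
    \<Longrightarrow> Sigma_t_act G c (block_swap a b) f \<in> carrier (Sigma_t G c)"
  by (simp add: Sigma_t_act_closed block_swap_permutes)

section \<open>Uniqueness of the bracket\<close>

lemma bilinear_op_eqI:
  assumes f: "bilinear_op R A B C f" and g: "bilinear_op R A B C g"
    and eq: "\<And>x y. x \<in> carrier A \<Longrightarrow> y \<in> carrier B \<Longrightarrow> f x y = g x y"
  shows "f = g"
proof -
  have fg: "f \<in> carrier A \<rightarrow>\<^sub>E carrier B \<rightarrow>\<^sub>E carrier C" "g \<in> carrier A \<rightarrow>\<^sub>E carrier B \<rightarrow>\<^sub>E carrier C"
    using f g by (simp_all add: bilinear_op_def)
  have "f x = g x" if "x \<in> carrier A" for x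
    by (rule PiE_ext[OF PiE_mem[OF fg(1) that] PiE_mem[OF fg(2) that]]) (use eq that in simp)
  then show ?thesis
    by (rule PiE_ext[OF fg])
qed

text \<open>For \<open>i\<close> in \<open>{1..m}\<close> this is the element t^(i-1) x t^(m-i).
  Indexing by degree and position, unlike in \<open>t_elem\<close>, lets permutations change the
  position at a fixed degree.\<close>

definition single :: "('a, 'b, 'x) module_scheme \<Rightarrow> nat \<Rightarrow> nat \<Rightarrow> 'b \<Rightarrow> nat \<Rightarrow> 'b"
  where "single G m i x = (\<lambda>k\<in>{1..m}. if k = i then x else \<zero>\<^bsub>G\<^esub>)"

lemma t_elem_eq_single: "t_elem G a x b = single G (a + 1 + b) (a + 1) x"
  by (simp add: t_elem_def single_def)

lemma act_transpose_single:
  assumes "i \<in> {1..m}" "j \<in> {1..m}" "single G m i x \<in> carrier (Sigma_t G m)"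
  shows "Sigma_t_act G m (transpose i j) (single G m i x) = single G m j x"
  using assms by (auto simp: Sigma_t_act_def single_def transpose_def intro!: restrict_ext)

context module
begin

lemma single_closed [simp]: "x \<in> carrier M \<Longrightarrow> single M m i x \<in> carrier (Sigma_t M m)"
  by (auto simp: single_def carrier_Sigma_t)

text \<open>Left multiplication by t keeps an entry in the last position, so it reaches every t^a x
  from \<open>x\<close>. In degree 0 there is no entry to move, while the right side would still
  contain \<open>x\<close>.\<close>

lemma t_mult_single:
  "t_mult M m (single M m m x) = single M (Suc m) (Suc m) x" if "m \<noteq> 0"
  using that by (auto simp: t_mult_def single_def intro!: restrict_ext)

lemma single_add:
  "x \<in> carrier M \<Longrightarrow> y \<in> carrier M \<Longrightarrow>
    single M m i (x \<oplus>\<^bsub>M\<^esub> y) = single M m i x \<oplus>\<^bsub>Sigma_t M m\<^esub> single M m i y"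
  by (auto simp: single_def Sigma_t_def intro!: restrict_ext)

lemma single_smult:
  "a \<in> carrier R \<Longrightarrow> x \<in> carrier M \<Longrightarrow>
    single M m i (a \<odot>\<^bsub>M\<^esub> x) = a \<odot>\<^bsub>Sigma_t M m\<^esub> single M m i x"
  by (auto simp: single_def Sigma_t_def intro!: restrict_ext)

lemma aug_single_1: "x \<in> carrier M \<Longrightarrow> aug M 1 (single M 1 1 x) = x"
  by (simp add: aug_def single_def)

text \<open>Every element arises from zero by placing its entries one at a time; biadditive
  operations are thereby reduced to single entries.\<close>

lemma Sigma_t_induct [consumes 1, case_names zero add]:
  assumes f: "f \<in> carrier (Sigma_t M m)"
    and zero: "P \<zero>\<^bsub>Sigma_t M m\<^esub>"
    and add: "\<And>f i x. \<lbrakk>f \<in> carrier (Sigma_t M m); i \<in> {1..m}; x \<in> carrier M; P f\<rbrakk>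
      \<Longrightarrow> P (f \<oplus>\<^bsub>Sigma_t M m\<^esub> single M m i x)"
  shows "P f"
proof -
  \<comment> \<open>The truncation of \<open>f\<close> to its first \<open>k\<close> positions, from
    zero at \<open>k = 0\<close> to \<open>f\<close> at \<open>k = m\<close>.\<close>
  let ?t = "\<lambda>k. \<lambda>i\<in>{1..m}. if i \<le> k then f i else \<zero>\<^bsub>M\<^esub>"
  have fi: "f i \<in> carrier M" if "i \<in> {1..m}" for i
    using Sigma_t_apply[OF f that] .
  have "P (?t k)" if "k \<le> m" for k
    using that
  proof (induction k)
    case 0
    have "?t 0 = \<zero>\<^bsub>Sigma_t M m\<^esub>"
      by (auto simp: Sigma_t_def intro!: restrict_ext)
    then show ?case
      using zero by simp
  next
    case (Suc k)
    have "?t (Suc k) = ?t k \<oplus>\<^bsub>Sigma_t M m\<^esub> single M m (Suc k) (f (Suc k))"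
      using fi by (auto simp: Sigma_t_def single_def le_Suc_eq intro!: restrict_ext)
    moreover have "?t k \<in> carrier (Sigma_t M m)"
      using fi by (auto simp: carrier_Sigma_t)
    ultimately show ?case
      using add[of "?t k" "Suc k" "f (Suc k)"] Suc fi[of "Suc k"] by simp
  qed
  moreover have "?t m = f"
    using f by (intro Sigma_t_eqI[of _ M m]) (auto simp: carrier_Sigma_t)
  ultimately show ?thesis
    by (metis order_refl)
qed

end

text \<open>The Jacobi identity plays no role in the uniqueness.\<close>

locale linear_bracket_over_kt = S_module_op R "Sigma_t G" "Sigma_t_act G" br
  for R :: "('a, 'r) ring_scheme" and G :: "('a, 'b, 'x) module_scheme" and br +
  assumes antisym: "\<lbrakk>f \<in> carrier (Sigma_t G m); g \<in> carrier (Sigma_t G n)\<rbrakk>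
      \<Longrightarrow> br m n f g = \<ominus>\<^bsub>Sigma_t G (m + n)\<^esub> Sigma_t_act G (m + n) (block_swap n m) (br n m g f)"
    and t_linear: "\<lbrakk>f \<in> carrier (Sigma_t G m); g \<in> carrier (Sigma_t G n)\<rbrakk>
      \<Longrightarrow> br (Suc m) n (t_mult G m f) g = t_mult G (m + n) (br m n f g)"
begin

lemma br_closed [simp]:
  "f \<in> carrier (Sigma_t G m) \<Longrightarrow> g \<in> carrier (Sigma_t G n)
    \<Longrightarrow> br m n f g \<in> carrier (Sigma_t G (m + n))"
  using bilinear[of m n] by (auto simp: bilinear_op_def)

lemma
  assumes f: "f \<in> carrier (Sigma_t G m)" and g: "g \<in> carrier (Sigma_t G n)"
  shows br_add_left: "f' \<in> carrier (Sigma_t G m) \<Longrightarrow>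
      br m n (f \<oplus>\<^bsub>Sigma_t G m\<^esub> f') g = br m n f g \<oplus>\<^bsub>Sigma_t G (m + n)\<^esub> br m n f' g"
    and br_add_right: "g' \<in> carrier (Sigma_t G n) \<Longrightarrow>
      br m n f (g \<oplus>\<^bsub>Sigma_t G n\<^esub> g') = br m n f g \<oplus>\<^bsub>Sigma_t G (m + n)\<^esub> br m n f g'"
    and br_smult_left: "a \<in> carrier R \<Longrightarrow>
      br m n (a \<odot>\<^bsub>Sigma_t G m\<^esub> f) g = a \<odot>\<^bsub>Sigma_t G (m + n)\<^esub> br m n f g"
    and br_smult_right: "a \<in> carrier R \<Longrightarrow>
      br m n f (a \<odot>\<^bsub>Sigma_t G n\<^esub> g) = a \<odot>\<^bsub>Sigma_t G (m + n)\<^esub> br m n f g"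
  using bilinear[of m n] f g by (auto simp: bilinear_op_def)

lemma
  shows br_zero_left: "g \<in> carrier (Sigma_t G n) \<Longrightarrow>
      br m n \<zero>\<^bsub>Sigma_t G m\<^esub> g = \<zero>\<^bsub>Sigma_t G (m + n)\<^esub>"
    and br_zero_right: "f \<in> carrier (Sigma_t G m) \<Longrightarrow>
      br m n f \<zero>\<^bsub>Sigma_t G n\<^esub> = \<zero>\<^bsub>Sigma_t G (m + n)\<^esub>"
proof -
  interpret S: module R "Sigma_t G k" for k by (rule module)
  show "g \<in> carrier (Sigma_t G n) \<Longrightarrow> br m n \<zero>\<^bsub>Sigma_t G m\<^esub> g = \<zero>\<^bsub>Sigma_t G (m + n)\<^esub>"
    using br_smult_left[of "\<zero>\<^bsub>Sigma_t G m\<^esub>" m g n "\<zero>\<^bsub>R\<^esub>"] by simp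
  show "f \<in> carrier (Sigma_t G m) \<Longrightarrow> br m n f \<zero>\<^bsub>Sigma_t G n\<^esub> = \<zero>\<^bsub>Sigma_t G (m + n)\<^esub>"
    using br_smult_right[of f m "\<zero>\<^bsub>Sigma_t G n\<^esub>" n "\<zero>\<^bsub>R\<^esub>"] by simp
qed

end

lemma (in module) linear_bracket_over_kt_unique:
  assumes "linear_bracket_over_kt R M br" "linear_bracket_over_kt R M br'"
    and eq: "\<And>x y. x \<in> carrier M \<Longrightarrow> y \<in> carrier M \<Longrightarrow>
      br 1 1 (single M 1 1 x) (single M 1 1 y) = br' 1 1 (single M 1 1 x) (single M 1 1 y)"
  shows "br = br'"
proof -
  interpret B: linear_bracket_over_kt R M br by fact
  interpret B': linear_bracket_over_kt R M br' by fact
  \<comment> \<open>Linearity over k[t] carries agreement from \<open>x\<close> to t^a x in the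
    first argument, for a fixed arbitrary second argument.\<close>
  have linear: "br (Suc a) n (single M (Suc a) (Suc a) x) g = br' (Suc a) n (single M (Suc a) (Suc a) x) g"
    if "br 1 n (single M 1 1 x) g = br' 1 n (single M 1 1 x) g"
      and x: "x \<in> carrier M" and g: "g \<in> carrier (Sigma_t M n)" for a n x g
  proof (induction a)
    case 0
    then show ?case using that(1) by (simp add: One_nat_def)
  next
    case (Suc a)
    then show ?case
      using B.t_linear[of "single M (Suc a) (Suc a) x" "Suc a" g n]
        B'.t_linear[of "single M (Suc a) (Suc a) x" "Suc a" g n] x g
      by (simp add: t_mult_single)
  qed
  \<comment> \<open>Antisymmetry puts the second argument first, so \<open>linear\<close> applies to
    it as well: first for t^b y against \<open>x\<close>, then for t^a x against t^b y.\<close>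
  have top: "br (Suc a) (Suc b) (single M (Suc a) (Suc a) x) (single M (Suc b) (Suc b) y)
      = br' (Suc a) (Suc b) (single M (Suc a) (Suc a) x) (single M (Suc b) (Suc b) y)"
    if xy: "x \<in> carrier M" "y \<in> carrier M" for a b x y
  proof (rule linear)
    have "br (Suc b) 1 (single M (Suc b) (Suc b) y) (single M 1 1 x)
      = br' (Suc b) 1 (single M (Suc b) (Suc b) y) (single M 1 1 x)"
      using xy by (intro linear eq) simp_all
    then show "br 1 (Suc b) (single M 1 1 x) (single M (Suc b) (Suc b) y)
      = br' 1 (Suc b) (single M 1 1 x) (single M (Suc b) (Suc b) y)"
      using xy B.antisym[of "single M 1 1 x" 1 "single M (Suc b) (Suc b) y" "Suc b"]
        B'.antisym[of "single M 1 1 x" 1 "single M (Suc b) (Suc b) y" "Suc b"] by simp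
  qed (use xy in simp_all)
  have single: "br m n (single M m i x) (single M n j y) = br' m n (single M m i x) (single M n j y)"
    if xy: "x \<in> carrier M" "y \<in> carrier M" and ij: "i \<in> {1..m}" "j \<in> {1..n}" for m n i j x y
  proof -
    have m: "m \<in> {1..m}" "n \<in> {1..n}"
      using ij by auto
    \<comment> \<open>A transposition moves the entry from the last position to any other, and
      equivariance carries the agreement along.\<close>
    have eqs: "single M m i x = Sigma_t_act M m (transpose m i) (single M m m x)"
      "single M n j y = Sigma_t_act M n (transpose n j) (single M n n y)"
      using m xy ij by (simp_all add: act_transpose_single)
    have p: "transpose m i \<in> carrier (sym_group m)" "transpose n j \<in> carrier (sym_group n)"
      using m ij by (simp_all add: sym_group_carrier permutes_swap_id)
    have "br m n (single M m m x) (single M n n y) = br' m n (single M m m x) (single M n n y)"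
      using top[OF xy, of "m - 1" "n - 1"] m by simp
    then show ?thesis
      unfolding eqs using B.equivariant[OF p] B'.equivariant[OF p] xy by simp
  qed
  \<comment> \<open>Additivity in each argument, by nested inductions on the entries of
    \<open>f\<close> and of \<open>g\<close>.\<close>
  have "br m n f g = br' m n f g" if f: "f \<in> carrier (Sigma_t M m)" and g: "g \<in> carrier (Sigma_t M n)"
    for m n f g
    using f
  proof (induction rule: Sigma_t_induct)
    case zero
    then show ?case using g by (simp add: B.br_zero_left B'.br_zero_left)
  next
    case (add f i x)
    have "br m n (single M m i x) g = br' m n (single M m i x) g"
      using g
    proof (induction rule: Sigma_t_induct)
      case zero
      then show ?case using \<open>x \<in> carrier M\<close> by (simp add: B.br_zero_right B'.br_zero_right)
    next
      case (add g j y)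
      then show ?case
        using \<open>i \<in> {1..m}\<close> \<open>x \<in> carrier M\<close>
        by (simp add: B.br_add_right B'.br_add_right single)
    qed
    then show ?case
      using add g by (simp add: B.br_add_left B'.br_add_left)
  qed
  then show ?thesis
    by (intro ext[of br] ext[of "br _"] bilinear_op_eqI[OF B.bilinear B'.bilinear])
qed

section \<open>The Jacobi and pre-Lie identities\<close>

context bilinear_product
begin

text \<open>With \<open>h = 0\<close> the product vanishes on the positions of its second factor. So
  the product of \<open>f\<close> and \<open>g\<close> fills the positions of \<open>f\<close>, and
  the swapped term those of \<open>g\<close> with a minus sign.\<close>

lemma associated_bracket_sigma_op:
  "associated_bracket (Sigma_t G) (Sigma_t_act G) (sigma_op G (\<lambda>_. \<zero>\<^bsub>G\<^esub>) pl) = sigma_op G (a_inv G) pl"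
proof (rule ext, rule ext)
  fix m n
  interpret S: module R "Sigma_t G k" for k by (rule module_Sigma_t)
  let ?pl = "sigma_op G (\<lambda>_. \<zero>\<^bsub>G\<^esub>) pl" and ?br = "sigma_op G (a_inv G) pl"
  have "?pl m n f g \<ominus>\<^bsub>Sigma_t G (m + n)\<^esub> Sigma_t_act G (m + n) (block_swap n m) (?pl n m g f)
      = ?br m n f g"
    if fg: "f \<in> carrier (Sigma_t G m)" "g \<in> carrier (Sigma_t G n)" for f g
  proof -
    note c = sigma_product.sigma_op_closed[OF sigma_product_zero]
    have c1: "?pl n m g f \<in> carrier (Sigma_t G (m + n))"
      using c[OF fg(2,1)] by (simp add: add.commute)
    have c2: "Sigma_t_act G (m + n) (block_swap n m) (?pl n m g f) \<in> carrier (Sigma_t G (m + n))"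
      using c1 by (intro act_block_swap_closed) simp_all
    show ?thesis
    proof (rule Sigma_t_blocks_eqI[of _ G m n])
      fix i assume i: "i \<in> {1..m}"
      then have "Sigma_t_act G (m + n) (block_swap n m) (?pl n m g f) i = \<zero>\<^bsub>G\<^esub>"
        using act_block_swap_left[OF c1 add.commute i] sigma_op_right[OF fg(2,1) i] by simp
      then show "(?pl m n f g \<ominus>\<^bsub>Sigma_t G (m + n)\<^esub> Sigma_t_act G (m + n) (block_swap n m) (?pl n m g f)) i
          = ?br m n f g i"
        using i fg Sigma_t_apply[OF fg(1) i]
        by (subst minus_Sigma_t[OF c[OF fg] c2]) (simp_all add: sigma_op_left a_minus_def)
    next
      fix i assume i: "i \<in> {1..n}"
      then have "Sigma_t_act G (m + n) (block_swap n m) (?pl n m g f) (m + i) = pl (g i) (aug G m f)"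
        using act_block_swap_right[OF c1 add.commute i] sigma_op_left[OF fg(2,1) i] by simp
      then show "(?pl m n f g \<ominus>\<^bsub>Sigma_t G (m + n)\<^esub> Sigma_t_act G (m + n) (block_swap n m) (?pl n m g f)) (m + i)
          = ?br m n f g (m + i)"
        using i fg Sigma_t_apply[OF fg(2) i]
        by (subst minus_Sigma_t[OF c[OF fg] c2]) (simp_all add: sigma_op_right a_minus_def)
    qed (use c[OF fg] c2 sigma_product.sigma_op_closed[OF sigma_product_a_inv fg] in simp_all)
  qed
  \<comment> \<open>Both sides are extensional, so equality on the carriers lifts through the two
    restrictions.\<close>
  moreover have "?br m n = (\<lambda>f\<in>carrier (Sigma_t G m). \<lambda>g\<in>carrier (Sigma_t G n). ?br m n f g)"
    by (auto simp: sigma_op_def)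
  ultimately show "associated_bracket (Sigma_t G) (Sigma_t_act G) ?pl m n = ?br m n"
    unfolding associated_bracket_def block_perm_12 by (metis (no_types, lifting) restrict_ext)
qed

text \<open>Exchanging the blocks exchanges the two kinds of entries up to sign, which is
  antisymmetry. For linearity, t f has the same sum as \<open>f\<close>, and its extra zero in front
  is annihilated by the product.\<close>

lemma linear_bracket_sigma_op: "linear_bracket_over_kt R G (sigma_op G (a_inv G) pl)"
proof (intro linear_bracket_over_kt.intro linear_bracket_over_kt_axioms.intro
    sigma_product.S_module_op_sigma_op sigma_product_a_inv)
  interpret S: module R "Sigma_t G k" for k by (rule module_Sigma_t)
  let ?br = "sigma_op G (a_inv G) pl"
  note c = sigma_product.sigma_op_closed[OF sigma_product_a_inv]
  fix m n f g
  assume fg: "f \<in> carrier (Sigma_t G m)" "g \<in> carrier (Sigma_t G n)"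
  have c': "?br n m g f \<in> carrier (Sigma_t G (m + n))"
    using c[OF fg(2,1)] by (simp add: add.commute)
  show "?br m n f g = \<ominus>\<^bsub>Sigma_t G (m + n)\<^esub> Sigma_t_act G (m + n) (block_swap n m) (?br n m g f)"
    using fg c' by (intro Sigma_t_blocks_eqI[of _ G m n])
      (simp_all add: act_block_swap_closed act_block_swap_left act_block_swap_right a_inv_Sigma_t c,
       simp_all add: sigma_op_left sigma_op_right Sigma_t_apply)
  show "?br (Suc m) n (t_mult G m f) g = t_mult G (m + n) (?br m n f g)"
  proof (rule Sigma_t_blocks_eqI[of _ G "Suc m" n])
    fix i assume i: "i \<in> {1..Suc m}"
    show "?br (Suc m) n (t_mult G m f) g i = t_mult G (m + n) (?br m n f g) i"
    proof (cases "i = 1")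
      case True
      then show ?thesis
        using fg by (simp add: sigma_op_left t_mult_closed) (simp add: t_mult_def)
    next
      case False
      then have "i - 1 \<in> {1..m}"
        using i by (auto simp: One_nat_def)
      then show ?thesis
        using False i fg
        by (simp add: sigma_op_left t_mult_closed del: atLeastAtMost_iff)
          (simp add: t_mult_def sigma_op_left)
    qed
  next
    fix i assume i: "i \<in> {1..n}"
    have "?br (Suc m) n (t_mult G m f) g (Suc m + i) = \<ominus>\<^bsub>G\<^esub> pl (g i) (aug G m f)"
      using sigma_op_right[OF t_mult_closed[OF fg(1)] fg(2) i] by (simp only: aug_t_mult[OF fg(1)])
    also have "\<dots> = ?br m n f g (m + i)"
      using sigma_op_right[OF fg i] by simp
    also have "\<dots> = t_mult G (m + n) (?br m n f g) (Suc m + i)"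
      using i by (simp add: t_mult_def)
    finally show "?br (Suc m) n (t_mult G m f) g (Suc m + i)
        = t_mult G (m + n) (?br m n f g) (Suc m + i)" .
  qed (use c[OF t_mult_closed[OF fg(1)] fg(2)] t_mult_closed[OF c[OF fg]] in simp_all)
qed

text \<open>The pre-Lie identity in the shape in which it occurs in the Jacobi sum.\<close>

definition pre_lie_defect :: "'c \<Rightarrow> 'c \<Rightarrow> 'c \<Rightarrow> 'c"
  where "pre_lie_defect x y z =
    pl x (pl y z) \<ominus>\<^bsub>G\<^esub> pl x (pl z y) \<oplus>\<^bsub>G\<^esub> (pl (pl x z) y \<ominus>\<^bsub>G\<^esub> pl (pl x y) z)"

lemma pre_lie_algebra_iff:
  "pre_lie_algebra R G pl \<longleftrightarrow>
    (\<forall>x\<in>carrier G. \<forall>y\<in>carrier G. \<forall>z\<in>carrier G. pre_lie_defect x y z = \<zero>\<^bsub>G\<^esub>)"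
proof -
  have "pre_lie_defect x y z = \<zero>\<^bsub>G\<^esub> \<longleftrightarrow>
      pl x (pl y z) \<ominus>\<^bsub>G\<^esub> pl (pl x y) z = pl x (pl z y) \<ominus>\<^bsub>G\<^esub> pl (pl x z) y"
    if "x \<in> carrier G" "y \<in> carrier G" "z \<in> carrier G" for x y z
    using that by (simp add: pre_lie_defect_def M.minus_eq_minus_iff)
  then show ?thesis
    by (auto simp: pre_lie_algebra_def pre_lie_algebra_axioms_def bilinear_pl module_axioms)
qed

text \<open>The left side of the axiom \<open>jacobi\<close> in its literal form, so that the axiom
  and the vanishing of this sum pass into each other by unfolding.\<close>

definition jacobiator :: "nat \<Rightarrow> nat \<Rightarrow> nat \<Rightarrow> (nat \<Rightarrow> 'c) \<Rightarrow> (nat \<Rightarrow> 'c) \<Rightarrow> (nat \<Rightarrow> 'c) \<Rightarrow> nat \<Rightarrow> 'c"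
  where "jacobiator m n l f g h = (let br = sigma_op G (a_inv G) pl in
    br m (n + l) f (br n l g h)
    \<oplus>\<^bsub>Sigma_t G (m + n + l)\<^esub>
    Sigma_t_act G (m + n + l) (block_perm (cycle_of_list [1, 2, 3]) [n, l, m])
      (br n (l + m) g (br l m h f))
    \<oplus>\<^bsub>Sigma_t G (m + n + l)\<^esub>
    Sigma_t_act G (m + n + l) (block_perm (cycle_of_list [1, 3, 2]) [l, m, n])
      (br l (m + n) h (br m n f g)))"

text \<open>At a position of \<open>f\<close>, the term with \<open>f\<close> outside gives
  \<open>f i\<close> multiplied by the commutator of the sums of \<open>g\<close> and
  \<open>h\<close>; the other two give the nested products of \<open>f i\<close> with these sums in
  both orders, with opposite signs. Together they are the defect, and the other blocks follow
  cyclically.\<close>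

lemma
  assumes f: "f \<in> carrier (Sigma_t G m)" and g: "g \<in> carrier (Sigma_t G n)"
    and h: "h \<in> carrier (Sigma_t G l)"
  shows jacobiator_closed: "jacobiator m n l f g h \<in> carrier (Sigma_t G (m + n + l))"
    and jacobiator_1: "i \<in> {1..m} \<Longrightarrow>
      jacobiator m n l f g h i = pre_lie_defect (f i) (aug G n g) (aug G l h)"
    and jacobiator_2: "i \<in> {1..n} \<Longrightarrow>
      jacobiator m n l f g h (m + i) = pre_lie_defect (g i) (aug G l h) (aug G m f)"
    and jacobiator_3: "i \<in> {1..l} \<Longrightarrow>
      jacobiator m n l f g h (m + n + i) = pre_lie_defect (h i) (aug G m f) (aug G n g)"
proof -
  interpret S: module R "Sigma_t G k" for k by (rule module_Sigma_t)
  let ?br = "sigma_op G (a_inv G) pl"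
  note c = sigma_product.sigma_op_closed[OF sigma_product_a_inv]
  let ?A = "?br m (n + l) f (?br n l g h)" and ?B = "?br n (l + m) g (?br l m h f)"
    and ?C = "?br l (m + n) h (?br m n f g)"
  let ?B' = "Sigma_t_act G (m + n + l) (block_swap (n + l) m) ?B"
    and ?C' = "Sigma_t_act G (m + n + l) (block_swap l (m + n)) ?C"
  have J: "jacobiator m n l f g h = ?A \<oplus>\<^bsub>Sigma_t G (m + n + l)\<^esub> ?B' \<oplus>\<^bsub>Sigma_t G (m + n + l)\<^esub> ?C'"
    unfolding jacobiator_def Let_def block_perm_123 block_perm_132 ..
  have A: "?A \<in> carrier (Sigma_t G (m + n + l))"
    using c[OF f c[OF g h]] by (simp add: add.assoc)
  have B: "?B \<in> carrier (Sigma_t G (m + n + l))"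
    using c[OF g c[OF h f]] by (simp add: ac_simps)
  have C: "?C \<in> carrier (Sigma_t G (m + n + l))"
    using c[OF h c[OF f g]] by (simp add: ac_simps)
  \<comment> \<open>The total degree in the form in which each block swap splits it.\<close>
  have sum: "m + n + l = n + l + m" "m + n + l = l + (m + n)"
    by simp_all
  have B': "?B' \<in> carrier (Sigma_t G (m + n + l))"
    by (rule act_block_swap_closed[OF B sum(1)])
  have C': "?C' \<in> carrier (Sigma_t G (m + n + l))"
    by (rule act_block_swap_closed[OF C sum(2)])
  note aug_br = sigma_product.aug_sigma_op[OF sigma_product_a_inv]
  note G = aug_closed[OF f] aug_closed[OF g] aug_closed[OF h]
  show "jacobiator m n l f g h \<in> carrier (Sigma_t G (m + n + l))"
    unfolding J using A B' C' by simp
  have J_apply: "jacobiator m n l f g h k = ?A k \<oplus>\<^bsub>G\<^esub> ?B' k \<oplus>\<^bsub>G\<^esub> ?C' k" if "k \<in> {1..m + n + l}" for k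
    unfolding J using that by (simp add: add_Sigma_t)
  note simps = pl_simps pre_lie_defect_def M.minus_add a_minus_def M.a_ac
  show "jacobiator m n l f g h i = pre_lie_defect (f i) (aug G n g) (aug G l h)" if i: "i \<in> {1..m}"
  proof -
    \<comment> \<open>Inside the bracket of \<open>h\<close> and \<open>f\<close> the entries of
      \<open>f\<close> follow the \<open>l\<close> positions of \<open>h\<close>.\<close>
    have i': "i \<in> {1..m + n}" "l + i \<in> {1..l + m}" "i \<in> {1..m + n + l}"
      using i by auto
    have "?A i = pl (f i) (pl (aug G n g) (aug G l h) \<oplus>\<^bsub>G\<^esub> \<ominus>\<^bsub>G\<^esub> pl (aug G l h) (aug G n g))"
      unfolding sigma_op_left[OF f c[OF g h] i] aug_br[OF g h] ..
    moreover have "?B' i = \<ominus>\<^bsub>G\<^esub> pl (\<ominus>\<^bsub>G\<^esub> pl (f i) (aug G l h)) (aug G n g)"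
      using act_block_swap_left[OF B sum(1) i] sigma_op_right[OF g c[OF h f] i'(2), of "a_inv G" pl]
        sigma_op_right[OF h f i, of "a_inv G" pl] by (simp add: add.assoc)
    moreover have "?C' i = \<ominus>\<^bsub>G\<^esub> pl (pl (f i) (aug G n g)) (aug G l h)"
      unfolding act_block_swap_left[OF C sum(2) i'(1)] sigma_op_right[OF h c[OF f g] i'(1)]
        sigma_op_left[OF f g i] ..
    ultimately show ?thesis
      using G Sigma_t_apply[OF f i] by (simp add: J_apply[OF i'(3)] simps)
  qed
  show "jacobiator m n l f g h (m + i) = pre_lie_defect (g i) (aug G l h) (aug G m f)" if i: "i \<in> {1..n}"
  proof -
    have i': "i \<in> {1..n + l}" "m + i \<in> {1..m + n}" "m + i \<in> {1..m + n + l}"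
      using i by auto
    have "?A (m + i) = \<ominus>\<^bsub>G\<^esub> pl (pl (g i) (aug G l h)) (aug G m f)"
      unfolding sigma_op_right[OF f c[OF g h] i'(1)] sigma_op_left[OF g h i] ..
    moreover have "?B' (m + i) = pl (g i) (pl (aug G l h) (aug G m f) \<oplus>\<^bsub>G\<^esub> \<ominus>\<^bsub>G\<^esub> pl (aug G m f) (aug G l h))"
      unfolding act_block_swap_right[OF B sum(1) i'(1)] sigma_op_left[OF g c[OF h f] i] aug_br[OF h f] ..
    moreover have "?C' (m + i) = \<ominus>\<^bsub>G\<^esub> pl (\<ominus>\<^bsub>G\<^esub> pl (g i) (aug G m f)) (aug G l h)"
      unfolding act_block_swap_left[OF C sum(2) i'(2)] sigma_op_right[OF h c[OF f g] i'(2)]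
        sigma_op_right[OF f g i] ..
    ultimately show ?thesis
      using G Sigma_t_apply[OF g i] by (simp add: J_apply[OF i'(3)] simps)
  qed
  show "jacobiator m n l f g h (m + n + i) = pre_lie_defect (h i) (aug G m f) (aug G n g)" if i: "i \<in> {1..l}"
  proof -
    have i': "n + i \<in> {1..n + l}" "i \<in> {1..l + m}" "m + n + i \<in> {1..m + n + l}"
      using i by auto
    have "?A (m + n + i) = \<ominus>\<^bsub>G\<^esub> pl (\<ominus>\<^bsub>G\<^esub> pl (h i) (aug G n g)) (aug G m f)"
      unfolding add.assoc[of m] sigma_op_right[OF f c[OF g h] i'(1)] sigma_op_right[OF g h i] ..
    moreover have "?B' (m + n + i) = \<ominus>\<^bsub>G\<^esub> pl (pl (h i) (aug G m f)) (aug G n g)"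
      using act_block_swap_right[OF B sum(1) i'(1)] sigma_op_right[OF g c[OF h f] i'(2), of "a_inv G" pl]
        sigma_op_left[OF h f i, of "a_inv G" pl] by (simp add: add.assoc)
    moreover have "?C' (m + n + i) = pl (h i) (pl (aug G m f) (aug G n g) \<oplus>\<^bsub>G\<^esub> \<ominus>\<^bsub>G\<^esub> pl (aug G n g) (aug G m f))"
      unfolding act_block_swap_right[OF C sum(2) i] sigma_op_left[OF h c[OF f g] i] aug_br[OF f g] ..
    ultimately show ?thesis
      using G Sigma_t_apply[OF h i] by (simp add: J_apply[OF i'(3)] simps)
  qed
qed

lemma twisted_lie_over_kt_sigma_op_iff:
  "twisted_lie_over_kt R G (sigma_op G (a_inv G) pl) \<longleftrightarrow> pre_lie_algebra R G pl"
proof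
  interpret S: module R "Sigma_t G k" for k by (rule module_Sigma_t)
  interpret B: linear_bracket_over_kt R G "sigma_op G (a_inv G) pl"
    by (rule linear_bracket_sigma_op)
  show "twisted_lie_over_kt R G (sigma_op G (a_inv G) pl)" if "pre_lie_algebra R G pl"
  proof -
    have defect: "pre_lie_defect x y z = \<zero>\<^bsub>G\<^esub>"
      if "x \<in> carrier G" "y \<in> carrier G" "z \<in> carrier G" for x y z
      using that \<open>pre_lie_algebra R G pl\<close> by (simp add: pre_lie_algebra_iff)
    have "jacobiator m n l f g h = \<zero>\<^bsub>Sigma_t G (m + n + l)\<^esub>"
      if fgh: "f \<in> carrier (Sigma_t G m)" "g \<in> carrier (Sigma_t G n)" "h \<in> carrier (Sigma_t G l)"
      for m n l f g h
    proof (rule Sigma_t_eqI[of _ G "m + n + l"])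
      have "\<forall>k\<in>{1..m + n + l}. jacobiator m n l f g h k = \<zero>\<^bsub>G\<^esub>"
        unfolding ball_blocks
        using fgh by (simp add: jacobiator_1 jacobiator_2 jacobiator_3 defect Sigma_t_apply)
      then show "jacobiator m n l f g h k = \<zero>\<^bsub>Sigma_t G (m + n + l)\<^esub> k" if "k \<in> {1..m + n + l}" for k
        using that by (simp add: zero_Sigma_t)
    qed (use fgh in \<open>simp_all add: jacobiator_closed\<close>)
    then show ?thesis
      by unfold_locales
        (simp_all only: jacobiator_def Let_def block_perm_12 B.t_linear B.antisym[symmetric])
  qed
  show "pre_lie_algebra R G pl" if "twisted_lie_over_kt R G (sigma_op G (a_inv G) pl)"
    unfolding pre_lie_algebra_iff
  proof (intro ballI)
    interpret L: twisted_lie_over_kt R G "sigma_op G (a_inv G) pl" by fact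
    fix x y z assume xyz: "x \<in> carrier G" "y \<in> carrier G" "z \<in> carrier G"
    note s = single_closed[OF xyz(1), of 1 1] single_closed[OF xyz(2), of 1 1]
      single_closed[OF xyz(3), of 1 1]
    \<comment> \<open>Elements of degree 1 have their only entry as sum, so the first position of
      their Jacobi sum is the defect of arbitrary \<open>x\<close>, \<open>y\<close>,
      \<open>z\<close>.\<close>
    have "pre_lie_defect x y z = jacobiator 1 1 1 (single G 1 1 x) (single G 1 1 y) (single G 1 1 z) 1"
      using jacobiator_1[OF s, of 1] xyz by (simp add: aug_single_1) (simp add: single_def)
    also have "jacobiator 1 1 1 (single G 1 1 x) (single G 1 1 y) (single G 1 1 z)
        = \<zero>\<^bsub>Sigma_t G (1 + 1 + 1)\<^esub>"
      unfolding jacobiator_def Let_def by (rule L.jacobi[OF s])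
    finally show "pre_lie_defect x y z = \<zero>\<^bsub>G\<^esub>"
      by (simp add: zero_Sigma_t)
  qed
qed

text \<open>The associator of the product is supported on the positions of its first factor, where
  it is the associator in \<gg> of \<open>f i\<close> and the two sums. The permutation (23) fixes
  this block, so the twisted identity is the one of \<gg> there and \<open>0 = 0\<close>
  elsewhere.\<close>

lemma twisted_pre_lie_sigma_op:
  assumes "pre_lie_algebra R G pl"
  shows "twisted_pre_lie_algebra R (Sigma_t G) (Sigma_t_act G) (sigma_op G (\<lambda>_. \<zero>\<^bsub>G\<^esub>) pl)"
proof (intro twisted_pre_lie_algebra.intro twisted_pre_lie_algebra_axioms.intro
    sigma_product.S_module_op_sigma_op sigma_product_zero)
  let ?pl = "sigma_op G (\<lambda>_. \<zero>\<^bsub>G\<^esub>) pl"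
  note c = sigma_product.sigma_op_closed[OF sigma_product_zero]
  interpret S: module R "Sigma_t G k" for k by (rule module_Sigma_t)
  let ?E = "\<lambda>m n l f g h. ?pl (m + n) l (?pl m n f g) h \<ominus>\<^bsub>Sigma_t G (m + n + l)\<^esub> ?pl m (n + l) f (?pl n l g h)"
  have closed: "?E m n l f g h \<in> carrier (Sigma_t G (m + n + l))"
    and left: "i \<in> {1..m} \<Longrightarrow> ?E m n l f g h i
      = pl (pl (f i) (aug G n g)) (aug G l h) \<ominus>\<^bsub>G\<^esub> pl (f i) (pl (aug G n g) (aug G l h))"
    and right: "i \<in> {1..n + l} \<Longrightarrow> ?E m n l f g h (m + i) = \<zero>\<^bsub>G\<^esub>"
    if f: "f \<in> carrier (Sigma_t G m)" and g: "g \<in> carrier (Sigma_t G n)"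
      and h: "h \<in> carrier (Sigma_t G l)" for m n l f g h i
  proof -
    note G = aug_closed[OF f] aug_closed[OF g] aug_closed[OF h]
    have c1: "?pl (m + n) l (?pl m n f g) h \<in> carrier (Sigma_t G (m + n + l))"
      using c[OF c[OF f g] h] .
    have c2: "?pl m (n + l) f (?pl n l g h) \<in> carrier (Sigma_t G (m + n + l))"
      using c[OF f c[OF g h]] by (simp add: add.assoc)
    show "?E m n l f g h \<in> carrier (Sigma_t G (m + n + l))"
      using c1 c2 by simp
    note minus = minus_Sigma_t[OF c1 c2]
    show "?E m n l f g h i
        = pl (pl (f i) (aug G n g)) (aug G l h) \<ominus>\<^bsub>G\<^esub> pl (f i) (pl (aug G n g) (aug G l h))"
      if i: "i \<in> {1..m}"
    proof -
      have i': "i \<in> {1..m + n}" "i \<in> {1..m + n + l}"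
        using i by auto
      show ?thesis
        unfolding minus[OF i'(2)] sigma_op_left[OF c[OF f g] h i'(1)] sigma_op_left[OF f g i]
          sigma_op_left[OF f c[OF g h] i] sigma_product.aug_sigma_op[OF sigma_product_zero g h]
        using G by simp
    qed
    show "?E m n l f g h (m + i) = \<zero>\<^bsub>G\<^esub>" if i: "i \<in> {1..n + l}"
    proof -
      \<comment> \<open>The inner product is zero at the positions of \<open>g\<close>, the outer
        one at those of \<open>h\<close>.\<close>
      have "\<forall>i\<in>{1..n + l}. ?pl (m + n) l (?pl m n f g) h (m + i) = \<zero>\<^bsub>G\<^esub>"
        unfolding ball_blocks
      proof (intro conjI ballI)
        fix i assume i: "i \<in> {1..n}"
        then have "m + i \<in> {1..m + n}"
          by simp
        then show "?pl (m + n) l (?pl m n f g) h (m + i) = \<zero>\<^bsub>G\<^esub>"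
          using sigma_op_left[OF c[OF f g] h] sigma_op_right[OF f g i] G by simp
      next
        fix i assume i: "i \<in> {1..l}"
        show "?pl (m + n) l (?pl m n f g) h (m + (n + i)) = \<zero>\<^bsub>G\<^esub>"
          using sigma_op_right[OF c[OF f g] h i] by (simp add: add.assoc)
      qed
      moreover have "m + i \<in> {1..m + n + l}"
        using i by auto
      ultimately show ?thesis
        using minus[of "m + i"] sigma_op_right[OF f c[OF g h] i] i by (simp add: a_minus_def)
    qed
  qed
  fix f m g n h l
  assume fgh: "f \<in> carrier (Sigma_t G m)" "g \<in> carrier (Sigma_t G n)" "h \<in> carrier (Sigma_t G l)"
  have p: "juxtapose m id (block_swap l n) permutes {1..m + n + l}"
    using juxtapose_permutes[OF permutes_id block_swap_permutes, of m l n] by (simp add: ac_simps)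
  have inv: "inv' (juxtapose m id (block_swap l n)) = juxtapose m id (block_swap n l)"
    using inv_juxtapose[OF permutes_id block_swap_permutes, of m l n] by (simp add: inv_block_swap)
  have E: "?E m l n f h g \<in> carrier (Sigma_t G (m + n + l))"
    using closed[OF fgh(1,3,2)] by (simp add: ac_simps)
  have "?E m n l f g h = Sigma_t_act G (m + n + l) (juxtapose m id (block_swap l n)) (?E m l n f h g)"
  proof (rule Sigma_t_blocks_eqI[of _ G m "n + l"])
    fix i assume i: "i \<in> {1..m}"
    have "pl (f i) (pl (aug G n g) (aug G l h)) \<ominus>\<^bsub>G\<^esub> pl (pl (f i) (aug G n g)) (aug G l h)
        = pl (f i) (pl (aug G l h) (aug G n g)) \<ominus>\<^bsub>G\<^esub> pl (pl (f i) (aug G l h)) (aug G n g)"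
      using fgh Sigma_t_apply[OF fgh(1) i] by (intro pre_lie_algebra.pre_lie[OF assms]) simp_all
    \<comment> \<open>The differences in the pre-Lie identity have the opposite sign to those in the
      twisted one, hence the negation.\<close>
    from arg_cong[OF this, of "a_inv G"] have "?E m n l f g h i = ?E m l n f h g i"
      unfolding left[OF fgh i] left[OF fgh(1,3,2) i]
      using fgh Sigma_t_apply[OF fgh(1) i] by (simp add: a_minus_def M.minus_add M.a_ac)
    then show "?E m n l f g h i
        = Sigma_t_act G (m + n + l) (juxtapose m id (block_swap l n)) (?E m l n f h g) i"
      using i E by (simp add: Sigma_t_act_apply inv juxtapose_def)
  next
    fix i assume i: "i \<in> {1..n + l}"
    \<comment> \<open>\<open>0 < i\<close> keeps \<open>m + i\<close> out of the first branch of
      \<open>juxtapose\<close>, and the swapped position stays among the zeros of the right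
      side.\<close>
    then have "block_swap n l i \<in> {1..l + n}" "0 < i"
      using permutes_in_image[OF block_swap_permutes, of n l i] by (simp_all add: add.commute)
    then show "?E m n l f g h (m + i)
        = Sigma_t_act G (m + n + l) (juxtapose m id (block_swap l n)) (?E m l n f h g) (m + i)"
      using i E right[OF fgh i] right[OF fgh(1,3,2), of "block_swap n l i"]
      by (simp add: Sigma_t_act_apply inv juxtapose_def)
  qed (use closed[OF fgh] E Sigma_t_act_closed[OF p E] in \<open>simp_all add: add.assoc\<close>)
  then show "?pl (m + n) l (?pl m n f g) h \<ominus>\<^bsub>Sigma_t G (m + n + l)\<^esub> ?pl m (n + l) f (?pl n l g h)
    = Sigma_t_act G (m + n + l) (block_perm (cycle_of_list [2, 3]) [m, l, n])
       (?pl (m + l) n (?pl m l f h) g \<ominus>\<^bsub>Sigma_t G (m + n + l)\<^esub> ?pl m (l + n) f (?pl l n h g))"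
    unfolding block_perm_23 by (simp add: ac_simps)
qed

end

section \<open>The equivalence\<close>

text \<open>The sum of an element of degree 1 is its only entry, so the bracket specialises to the
  formula of the theorem.\<close>

lemma (in bilinear_product) sigma_br_single:
  assumes xy: "x \<in> carrier G" "y \<in> carrier G"
  shows "sigma_op G (a_inv G) pl 1 1 (single G 1 1 x) (single G 1 1 y)
    = t_elem G 0 (pl x y) 1 \<ominus>\<^bsub>Sigma_t G 2\<^esub> t_elem G 1 (pl y x) 0"
proof (rule Sigma_t_blocks_eqI[of _ G 1 1])
  interpret S: module R "Sigma_t G k" for k by (rule module_Sigma_t)
  note s = single_closed[OF xy(1), of 1 1] single_closed[OF xy(2), of 1 1]
  have t: "t_elem G 0 (pl x y) 1 \<in> carrier (Sigma_t G 2)" "t_elem G 1 (pl y x) 0 \<in> carrier (Sigma_t G 2)"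
    using xy by (simp_all add: t_elem_eq_single)
  show "sigma_op G (a_inv G) pl 1 1 (single G 1 1 x) (single G 1 1 y) \<in> carrier (Sigma_t G (1 + 1))"
    by (rule sigma_product.sigma_op_closed[OF sigma_product_a_inv s])
  show "t_elem G 0 (pl x y) 1 \<ominus>\<^bsub>Sigma_t G 2\<^esub> t_elem G 1 (pl y x) 0 \<in> carrier (Sigma_t G (1 + 1))"
    using t by simp
  fix i :: nat assume i: "i \<in> {1..1}"
  then have [simp]: "i = 1"
    by simp
  show "sigma_op G (a_inv G) pl 1 1 (single G 1 1 x) (single G 1 1 y) i
      = (t_elem G 0 (pl x y) 1 \<ominus>\<^bsub>Sigma_t G 2\<^esub> t_elem G 1 (pl y x) 0) i"
    using sigma_op_left[OF s i, of "a_inv G" pl] xy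
    by (simp add: minus_Sigma_t[OF t] aug_single_1) (simp add: single_def t_elem_def a_minus_def)
  show "sigma_op G (a_inv G) pl 1 1 (single G 1 1 x) (single G 1 1 y) (1 + i)
      = (t_elem G 0 (pl x y) 1 \<ominus>\<^bsub>Sigma_t G 2\<^esub> t_elem G 1 (pl y x) 0) (1 + i)"
    using sigma_op_right[OF s i, of "a_inv G" pl] xy
    by (simp add: minus_Sigma_t[OF t] aug_single_1) (simp add: single_def t_elem_def a_minus_def)
qed

lemma twisted_lie_over_kt_imp_linear_bracket:
  assumes "twisted_lie_over_kt R G br"
  shows "linear_bracket_over_kt R G br"
proof -
  interpret twisted_lie_over_kt R G br by fact
  show ?thesis
    by unfold_locales (rule antisym[unfolded block_perm_12] t_linear; assumption)+
qed

lemma (in module) linear_bracket_over_kt_eq_sigma_op: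
  assumes "linear_bracket_over_kt R M br"
  obtains pl where "bilinear_product R M pl" "br = sigma_op M (a_inv M) pl"
proof -
  interpret S: module R "Sigma_t M k" for k by (rule module_Sigma_t)
  interpret B: linear_bracket_over_kt R M br by fact
  let ?e = "single M 1 1"
  \<comment> \<open>The product is read off as the first of the two entries of the bracket; the
    restrictions make it extensional, as \<open>bilinear_op\<close> demands.\<close>
  define pl where "pl = (\<lambda>x\<in>carrier M. \<lambda>y\<in>carrier M. br 1 1 (?e x) (?e y) 1)"
  have "bilinear_op R M M M pl"
    unfolding bilinear_op_def
  proof (intro conjI ballI)
    have "br 1 1 (?e x) (?e y) 1 \<in> carrier M" if "x \<in> carrier M" "y \<in> carrier M" for x y
      using that by (intro Sigma_t_apply[OF B.br_closed]) simp_all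
    then show "pl \<in> carrier M \<rightarrow>\<^sub>E carrier M \<rightarrow>\<^sub>E carrier M"
      by (auto simp: pl_def)
  qed (simp_all add: pl_def single_add single_smult B.br_add_left B.br_add_right B.br_smult_left
      B.br_smult_right add_Sigma_t smult_Sigma_t)
  then have pl: "bilinear_product R M pl"
    by (simp add: bilinear_product_def bilinear_product_axioms_def module_axioms)
  interpret P: bilinear_product R M pl by (rule pl)
  have "br = sigma_op M (a_inv M) pl"
  proof (rule linear_bracket_over_kt_unique[OF assms P.linear_bracket_sigma_op])
    fix x y assume xy: "x \<in> carrier M" "y \<in> carrier M"
    note s = single_closed[OF xy(1), of 1 1] single_closed[OF xy(2), of 1 1]
    show "br 1 1 (?e x) (?e y) = sigma_op M (a_inv M) pl 1 1 (?e x) (?e y)"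
    proof (rule Sigma_t_blocks_eqI[of _ M 1 1])
      fix i :: nat assume i: "i \<in> {1..1}"
      then have [simp]: "i = 1"
        by simp
      show "br 1 1 (?e x) (?e y) i = sigma_op M (a_inv M) pl 1 1 (?e x) (?e y) i"
        using sigma_op_left[OF s i, of "a_inv M" pl] xy
        by (simp add: aug_single_1) (simp add: single_def pl_def)
      \<comment> \<open>The second entry is no further datum: antisymmetry makes it the negative of
        the first entry of \<open>br 1 1 (?e y) (?e x)\<close>.\<close>
      have "br 1 1 (?e x) (?e y) (1 + i)
          = (\<ominus>\<^bsub>Sigma_t M (1 + 1)\<^esub> Sigma_t_act M (1 + 1) (block_swap 1 1) (br 1 1 (?e y) (?e x))) (1 + i)"
        by (subst B.antisym[OF s]) (rule refl)
      also have "\<dots> = \<ominus>\<^bsub>M\<^esub> br 1 1 (?e y) (?e x) i"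
        using i B.br_closed[OF s(2,1)]
        by (subst a_inv_Sigma_t) (simp_all add: act_block_swap_closed act_block_swap_right
            del: one_add_one)
      also have "\<dots> = sigma_op M (a_inv M) pl 1 1 (?e x) (?e y) (1 + i)"
        using sigma_op_right[OF s i, of "a_inv M" pl] xy
        by (simp add: aug_single_1) (simp add: single_def pl_def)
      finally show "br 1 1 (?e x) (?e y) (1 + i) = sigma_op M (a_inv M) pl 1 1 (?e x) (?e y) (1 + i)" .
    qed (use B.br_closed[OF s] sigma_product.sigma_op_closed[OF P.sigma_product_a_inv s] in simp_all)
  qed
  with pl show ?thesis
    by (rule that)
qed

text \<open>Replaces the formula on \<gg> by an equation between whole brackets, to which both
  uniqueness claims then reduce.\<close>

lemma (in module) linear_bracket_over_kt_eq_sigma_op_iff: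
  assumes br: "linear_bracket_over_kt R M br" and pl: "bilinear_product R M pl"
  shows "(\<forall>x\<in>carrier M. \<forall>y\<in>carrier M. br 1 1 (t_elem M 0 x 0) (t_elem M 0 y 0)
      = t_elem M 0 (pl x y) 1 \<ominus>\<^bsub>Sigma_t M 2\<^esub> t_elem M 1 (pl y x) 0)
    \<longleftrightarrow> br = sigma_op M (a_inv M) pl"
proof -
  interpret P: bilinear_product R M pl by fact
  have "t_elem M 0 x 0 = single M 1 1 x" for x
    by (simp add: t_elem_eq_single)
  then show ?thesis
    using linear_bracket_over_kt_unique[OF br P.linear_bracket_sigma_op]
    by (auto simp: P.sigma_br_single[symmetric])
qed

text \<open>The first position of the product of two elements of degree 1 gives back
  \<open>pl\<close>, and extensionality does the rest.\<close>

lemma (in module) sigma_op_inject: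
  assumes "bilinear_product R M pl" "bilinear_product R M pl'"
    and eq: "sigma_op M h pl = sigma_op M h pl'"
  shows "pl = pl'"
proof -
  interpret P: bilinear_product R M pl by fact
  interpret P': bilinear_product R M pl' by fact
  show ?thesis
  proof (rule bilinear_op_eqI[OF P.bilinear_pl P'.bilinear_pl])
    fix x y assume xy: "x \<in> carrier M" "y \<in> carrier M"
    note s = single_closed[OF xy(1), of 1 1] single_closed[OF xy(2), of 1 1]
    have "p x y = sigma_op M h p 1 1 (single M 1 1 x) (single M 1 1 y) 1" if "p \<in> {pl, pl'}" for p
      using sigma_op_left[OF s, of 1 h p] xy by (simp add: aug_single_1) (simp add: single_def)
    from this[of pl] this[of pl'] show "pl x y = pl' x y"
      by (simp add: eq)
  qed
qed

lemma pre_lie_algebra_imp_bilinear_product: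
  "pre_lie_algebra R G pl \<Longrightarrow> bilinear_product R G pl"
  by (simp add: pre_lie_algebra_def pre_lie_algebra_axioms_def bilinear_product_def
      bilinear_product_axioms_def)

text \<open>The first two conjuncts make the formula the graph of a bijection between brackets and
  pre-Lie products; the third is the origin of the brackets in twisted pre-Lie algebras.\<close>

theorem proposition3p3p3:
  fixes R :: "('a, 'r) ring_scheme" and G :: "('a, 'b, 'x) module_scheme"
  assumes "cring R" and "module R G"
  shows
    "(\<forall>br. twisted_lie_over_kt R G br \<longrightarrow>
       (\<exists>!pl. pre_lie_algebra R G pl \<and>
          (\<forall>x\<in>carrier G. \<forall>y\<in>carrier G.
             br 1 1 (t_elem G 0 x 0) (t_elem G 0 y 0)
             = t_elem G 0 (pl x y) 1 \<ominus>\<^bsub>Sigma_t G 2\<^esub> t_elem G 1 (pl y x) 0))) \<and>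
     (\<forall>pl. pre_lie_algebra R G pl \<longrightarrow>
       (\<exists>!br. twisted_lie_over_kt R G br \<and>
          (\<forall>x\<in>carrier G. \<forall>y\<in>carrier G.
             br 1 1 (t_elem G 0 x 0) (t_elem G 0 y 0)
             = t_elem G 0 (pl x y) 1 \<ominus>\<^bsub>Sigma_t G 2\<^esub> t_elem G 1 (pl y x) 0))) \<and>
     (\<forall>br. twisted_lie_over_kt R G br \<longrightarrow>
       (\<exists>pl. twisted_pre_lie_algebra R (Sigma_t G) (Sigma_t_act G) pl \<and>
          br = associated_bracket (Sigma_t G) (Sigma_t_act G) pl))"
    (is "?lie_to_pre_lie \<and> ?pre_lie_to_lie \<and> ?associated")
proof -
  interpret module R G by fact
  note linear = twisted_lie_over_kt_imp_linear_bracket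
  note bilinear = pre_lie_algebra_imp_bilinear_product
  have to_pre_lie: "\<exists>pl. pre_lie_algebra R G pl \<and> br = sigma_op G (a_inv G) pl"
    if "twisted_lie_over_kt R G br" for br
    using that by (metis linear linear_bracket_over_kt_eq_sigma_op
        bilinear_product.twisted_lie_over_kt_sigma_op_iff)
  have to_lie: "twisted_lie_over_kt R G (sigma_op G (a_inv G) pl)" if "pre_lie_algebra R G pl" for pl
    using that by (simp add: bilinear bilinear_product.twisted_lie_over_kt_sigma_op_iff)
  note iff = linear_bracket_over_kt_eq_sigma_op_iff[OF linear bilinear]
  have ?lie_to_pre_lie
  proof (intro allI impI)
    fix br assume br: "twisted_lie_over_kt R G br"
    then obtain pl where pl: "pre_lie_algebra R G pl" "br = sigma_op G (a_inv G) pl"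
      using to_pre_lie by blast
    show "\<exists>!pl. pre_lie_algebra R G pl \<and>
        (\<forall>x\<in>carrier G. \<forall>y\<in>carrier G. br 1 1 (t_elem G 0 x 0) (t_elem G 0 y 0)
          = t_elem G 0 (pl x y) 1 \<ominus>\<^bsub>Sigma_t G 2\<^esub> t_elem G 1 (pl y x) 0)"
    proof (rule ex1I[of _ pl])
      fix pl' assume "pre_lie_algebra R G pl' \<and>
        (\<forall>x\<in>carrier G. \<forall>y\<in>carrier G. br 1 1 (t_elem G 0 x 0) (t_elem G 0 y 0)
          = t_elem G 0 (pl' x y) 1 \<ominus>\<^bsub>Sigma_t G 2\<^esub> t_elem G 1 (pl' y x) 0)"
      then have "pre_lie_algebra R G pl'" "br = sigma_op G (a_inv G) pl'"
        using iff[OF br] by blast+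
      then show "pl' = pl"
        using pl sigma_op_inject[OF bilinear bilinear] by metis
    qed (use pl iff[OF br] in blast)
  qed
  moreover have ?pre_lie_to_lie
  proof (intro allI impI)
    fix pl assume pl: "pre_lie_algebra R G pl"
    show "\<exists>!br. twisted_lie_over_kt R G br \<and>
        (\<forall>x\<in>carrier G. \<forall>y\<in>carrier G. br 1 1 (t_elem G 0 x 0) (t_elem G 0 y 0)
          = t_elem G 0 (pl x y) 1 \<ominus>\<^bsub>Sigma_t G 2\<^esub> t_elem G 1 (pl y x) 0)"
      \<comment> \<open>The first instance of \<open>iff\<close> gives existence, the second one
        uniqueness.\<close>
      using iff[OF to_lie[OF pl] pl] iff[OF _ pl] to_lie[OF pl]
      by (intro ex1I[of _ "sigma_op G (a_inv G) pl"]) blast+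
  qed
  moreover have ?associated
    \<comment> \<open>The witness is \<open>sigma_op\<close> with \<open>h = 0\<close>, built from
      the pre-Lie product that belongs to the bracket.\<close>
    using to_pre_lie bilinear bilinear_product.twisted_pre_lie_sigma_op
      bilinear_product.associated_bracket_sigma_op by metis
  ultimately show ?thesis
    by blast
qed

end
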